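(* There exist a domain $\Omega$, a ball $U$ and a continuous Hamiltonian $H:\overline U\times\mathbb{R}^n\to\mathbb{R}$ satisfying properties (1)--(4) of the context with the following property. For every continuous $r:(0,\infty)\to(-\infty,0]$ with $\lim_{\lambda\to0^+}r(\lambda)=0$ that is not identically zero on any interval $(0,\varepsilon)$, $\varepsilon>0$, there exists a continuous nondecreasing function $\phi:(0,\infty)\to(0,\infty)$ with $\lim_{\lambda\to0^+}\phi(\lambda)=0$ and a sequence $\lambda_j\to0^+$ such that $$\lim_{j\to\infty}\frac{r(\lambda_j)}{\phi(\lambda_j)}=-\infty$$ and the sequence $\big\{u_{\lambda_j}+c(\lambda_j)/\phi(\lambda_j)\big\}_{j}$ diverges, i.e. it does not converge locally uniformly in $\Omega$ as $j\to\infty$.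
   Context: $\Omega\subset\mathbb{R}^n$ is open, bounded, connected, with $0\in\Omega$; $U=B(0,R_0)$ is an open ball with $2\Omega\subseteq U$. Properties: (1) for each $R>0$ there is $C_R$ with $|H(x,p)-H(y,p)|\le C_R|x-y|$ and $|H(x,p)-H(x,q)|\le C_R|p-q|$ for $x,y\in\overline U$, $|p|,|q|\le R$; (2) $\lim_{|p|\to\infty}\min_{x\in\overline U}H(x,p)=+\infty$; (3) $p\mapsto H(x,p)$ is convex for each $x\in\overline U$; (4) $\Omega$ is star-shaped with respect to the origin and there is $\kappa>0$ such that $\mathrm{dist}(x,\overline\Omega)\ge\kappa s$ for all $s>0$, $x\in(1+s)\partial\Omega$. $\Omega_\lambda=(1+r(\lambda))\Omega$ for $\lambda>0$ small enough that $1+r(\lambda)>0$. $v\in C(\overline D)$ is a state-constraint solution of $\delta v+H(x,Dv)=0$ in an open set $D$ if it is a viscosity subsolution in $D$ and a viscosity supersolution on $\overline D$, the latter meaning: whenever $\varphi\in C^1(\overline D)$ and $v-\varphi$ has a local minimum relative to $\overline D$ at $x\in\overline D$, then $\delta v(x)+H(x,D\varphi(x))\ge0$. $u_\lambda\in C(\overline{\Omega_\lambda})$ is the unique state-constraint solution of $\phi(\lambda)u_\lambda+H(x,Du_\lambda)=0$ in $\Omega_\lambda$. $c(\lambda)=\inf\{c\in\mathbb{R}:H(x,Dv)\le c\text{ has a viscosity subsolution in }\Omega_\lambda\}$ is the additive eigenvalue of $H$ in $\Omega_\lambda$. *)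

theory Defs
  imports "HOL-Analysis.Analysis"
begin

text \<open>\<open>f \<in> C\<^sup>1(S)\<close> with gradient \<open>Df\<close>. If \<open>S\<close> is not open (below: the closure of a domain) this means
  that \<open>f\<close> is continuously differentiable on an open neighbourhood of \<open>S\<close>.\<close>

definition C1_on :: "'a::euclidean_space set \<Rightarrow> ('a \<Rightarrow> real) \<Rightarrow> ('a \<Rightarrow> 'a) \<Rightarrow> bool" where
  "C1_on S f Df \<longleftrightarrow>
     (\<exists>W. open W \<and> S \<subseteq> W \<and> (\<forall>x\<in>W. GDERIV f x :> Df x) \<and> continuous_on W Df)"

text \<open>Viscosity sub- and supersolutions of \<open>F(x, v, Dv) = 0\<close>. In the supersolution property the
  minimum is taken relative to \<open>S\<close>, which need not be open.\<close>

definition viscosity_subsolution ::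
    "('a::euclidean_space \<Rightarrow> real \<Rightarrow> 'a \<Rightarrow> real) \<Rightarrow> 'a set \<Rightarrow> ('a \<Rightarrow> real) \<Rightarrow> bool" where
  "viscosity_subsolution F D v \<longleftrightarrow> continuous_on D v \<and>
     (\<forall>\<psi> D\<psi>. \<forall>x\<in>D. C1_on D \<psi> D\<psi> \<longrightarrow>
        (\<forall>\<^sub>F y in at x within D. v y - \<psi> y \<le> v x - \<psi> x) \<longrightarrow> F x (v x) (D\<psi> x) \<le> 0)"

definition viscosity_supersolution ::
    "('a::euclidean_space \<Rightarrow> real \<Rightarrow> 'a \<Rightarrow> real) \<Rightarrow> 'a set \<Rightarrow> ('a \<Rightarrow> real) \<Rightarrow> bool" where
  "viscosity_supersolution F S v \<longleftrightarrow> continuous_on S v \<and>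
     (\<forall>\<psi> D\<psi>. \<forall>x\<in>S. C1_on S \<psi> D\<psi> \<longrightarrow>
        (\<forall>\<^sub>F y in at x within S. v x - \<psi> x \<le> v y - \<psi> y) \<longrightarrow> 0 \<le> F x (v x) (D\<psi> x))"

definition state_constraint_solution ::
    "real \<Rightarrow> ('a::euclidean_space \<Rightarrow> 'a \<Rightarrow> real) \<Rightarrow> 'a set \<Rightarrow> ('a \<Rightarrow> real) \<Rightarrow> bool" where
  "state_constraint_solution \<delta> H D v \<longleftrightarrow> continuous_on (closure D) v \<and>
     viscosity_subsolution (\<lambda>x z p. \<delta> * z + H x p) D v \<and>
     viscosity_supersolution (\<lambda>x z p. \<delta> * z + H x p) (closure D) v"

text \<open>A solution lives on \<open>closure D\<close>; as a total function it is normalised to \<open>0\<close> elsewhere, so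
  that uniqueness on \<open>closure D\<close> becomes uniqueness of the function.\<close>

definition the_state_constraint_solution ::
    "real \<Rightarrow> ('a::euclidean_space \<Rightarrow> 'a \<Rightarrow> real) \<Rightarrow> 'a set \<Rightarrow> 'a \<Rightarrow> real" where
  "the_state_constraint_solution \<delta> H D =
     (THE v. state_constraint_solution \<delta> H D v \<and> (\<forall>x. x \<notin> closure D \<longrightarrow> v x = 0))"

definition additive_eigenvalue ::
    "('a::euclidean_space \<Rightarrow> 'a \<Rightarrow> real) \<Rightarrow> 'a set \<Rightarrow> real" where
  "additive_eigenvalue H D = Inf {c. \<exists>v. viscosity_subsolution (\<lambda>x z p. H x p - c) D v}"

definition locally_lipschitz_hamiltonian ::
    "'a::euclidean_space set \<Rightarrow> ('a \<Rightarrow> 'a \<Rightarrow> real) \<Rightarrow> bool" where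
  "locally_lipschitz_hamiltonian U H \<longleftrightarrow>
     (\<forall>R>0. \<exists>C. \<forall>x\<in>closure U. \<forall>y\<in>closure U. \<forall>p q. norm p \<le> R \<longrightarrow> norm q \<le> R \<longrightarrow>
        \<bar>H x p - H y p\<bar> \<le> C * norm (x - y) \<and> \<bar>H x p - H x q\<bar> \<le> C * norm (p - q))"

text \<open>For continuous \<open>H\<close> and bounded nonempty \<open>U\<close> the infimum over \<open>closure U\<close> is a minimum.\<close>

definition coercive_hamiltonian ::
    "'a::euclidean_space set \<Rightarrow> ('a \<Rightarrow> 'a \<Rightarrow> real) \<Rightarrow> bool" where
  "coercive_hamiltonian U H \<longleftrightarrow> filterlim (\<lambda>p. INF x\<in>closure U. H x p) at_top at_infinity"

definition convex_hamiltonian ::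
    "'a::euclidean_space set \<Rightarrow> ('a \<Rightarrow> 'a \<Rightarrow> real) \<Rightarrow> bool" where
  "convex_hamiltonian U H \<longleftrightarrow> (\<forall>x\<in>closure U. convex_on UNIV (H x))"

definition dilate :: "real \<Rightarrow> 'a::real_vector set \<Rightarrow> 'a set" where
  "dilate t S = (\<lambda>x. t *\<^sub>R x) ` S"

definition strongly_star_shaped :: "'a::euclidean_space set \<Rightarrow> bool" where
  "strongly_star_shaped \<Omega> \<longleftrightarrow>
     (\<forall>x\<in>\<Omega>. closed_segment 0 x \<subseteq> \<Omega>) \<and>
     (\<exists>\<kappa>>0. \<forall>s>0. \<forall>x\<in>dilate (1 + s) (frontier \<Omega>). \<kappa> * s \<le> infdist x (closure \<Omega>))"

definition converges_locally_uniformly ::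
    "'a::euclidean_space set \<Rightarrow> (nat \<Rightarrow> 'a \<Rightarrow> real) \<Rightarrow> bool" where
  "converges_locally_uniformly \<Omega> f \<longleftrightarrow>
     (\<exists>g. \<forall>K. compact K \<longrightarrow> K \<subseteq> \<Omega> \<longrightarrow> uniform_limit K f g sequentially)"

end

theory Submission
  imports Defs
begin

text \<open>Take \<open>H(x, p) = |p| - V(x \<bullet> e)\<close> on cubes, with \<open>e\<close> a coordinate direction and \<open>V\<close> decreasing from the
  centre towards the two faces \<open>x \<bullet> e = \<plusminus>1\<close>. On the cube of half-width \<open>1 - s\<close> the additive
  eigenvalue is \<open>- min V\<close>, and the oscillating term \<open>osc s\<close> of \<open>V\<close> decides which of the two faces
  carries the minimum; its sign changes infinitely often as \<open>s \<rightarrow> 0\<close>. If the discount is small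
  compared with the difference of \<open>V\<close> on the two faces, it is optimal to walk straight to the
  better face from everywhere, so the state-constraint solution is a \<open>C\<^sup>1\<close> function of \<open>x \<bullet> e\<close> solving
  a linear ODE, and the normalised solution is decreasing or increasing along \<open>e\<close>, with a slope
  bounded away from zero near the centre. Since \<open>r\<close> takes all small negative values arbitrarily
  close to \<open>0\<close>, one can choose \<open>\<lambda>\<^sub>j\<close> so that the better face alternates, and then a discount \<open>\<phi>\<close> that
  is small enough at every \<open>\<lambda>\<^sub>j\<close>.\<close>

section \<open>Viscosity subsolutions and test functions\<close>

text \<open>A steep paraboloid centred at \<open>x0\<close> pushes the maximum of
  \<open>v - \<psi>\<close> over a small closed ball into its interior. So points where some test
  function touches from above are dense in \<open>D\<close>, however irregular \<open>v\<close>
  is.\<close>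

lemma exists_C1_touching_above:
  fixes v :: "'a::euclidean_space \<Rightarrow> real"
  assumes D: "open D" and v: "continuous_on D v" and x0: "x0 \<in> D" and \<epsilon>: "\<epsilon> > 0"
  obtains x \<psi> D\<psi> where "x \<in> D" "dist x x0 < \<epsilon>" "C1_on D \<psi> D\<psi>"
    "\<forall>\<^sub>F y in at x within D. v y - \<psi> y \<le> v x - \<psi> x"
proof -
  obtain r0 where r0: "r0 > 0" "cball x0 r0 \<subseteq> D"
    using D x0 open_contains_cball by blast
  define r where "r = min r0 (\<epsilon>/2)"
  have r: "r > 0" "cball x0 r \<subseteq> D" "r < \<epsilon>"
    using r0 \<epsilon> by (auto simp: r_def)
  have vr: "continuous_on (cball x0 r) v"
    using v r continuous_on_subset by blast
  have "bounded (v ` cball x0 r)"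
    using compact_continuous_image[OF vr] compact_imp_bounded by auto
  then obtain M where M: "M > 0" "\<And>x. x \<in> cball x0 r \<Longrightarrow> \<bar>v x\<bar> \<le> M"
    by (auto simp: bounded_pos)
  \<comment> \<open>On the sphere of radius \<open>r\<close> the paraboloid equals
    \<open>3 * M\<close>, whereas at the maximum point it is at most \<open>v x - v x0\<close>,
    hence at most \<open>2 * M\<close>.\<close>
  define K where "K = 3 * M / r\<^sup>2"
  define \<psi> where "\<psi> = (\<lambda>x. K * ((x - x0) \<bullet> (x - x0)))"
  have "continuous_on (cball x0 r) (\<lambda>x. v x - \<psi> x)"
    unfolding \<psi>_def using vr by (intro continuous_intros)
  then obtain x where x: "x \<in> cball x0 r" "\<And>y. y \<in> cball x0 r \<Longrightarrow> v y - \<psi> y \<le> v x - \<psi> x"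
    using continuous_attains_sup[of "cball x0 r" "\<lambda>x. v x - \<psi> x"] r by fastforce
  have "v x0 - \<psi> x0 \<le> v x - \<psi> x" using x r by simp
  moreover have "\<bar>v x0\<bar> \<le> M" "\<bar>v x\<bar> \<le> M" using M x r by auto
  ultimately have "\<psi> x < 3 * M" using M by (simp add: \<psi>_def)
  then have "(dist x x0)\<^sup>2 < r\<^sup>2"
    using M r by (simp add: \<psi>_def K_def dist_norm power2_norm_eq_inner field_simps)
  then have d: "dist x x0 < r" using r by (simp add: power2_less_imp_less)
  have "GDERIV \<psi> x :> (2 * K) *\<^sub>R (x - x0)" for x
    unfolding \<psi>_def gderiv_def
    by (auto intro!: derivative_eq_intros simp: inner_commute algebra_simps)
  then have "C1_on D \<psi> (\<lambda>x. (2 * K) *\<^sub>R (x - x0))"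
    unfolding C1_on_def by (intro exI[of _ UNIV]) (auto intro!: continuous_intros)
  moreover have "\<forall>\<^sub>F y in at x within D. v y - \<psi> y \<le> v x - \<psi> x"
    unfolding eventually_at_topological
    by (intro exI[of _ "ball x0 r"]) (use x d in \<open>auto simp: dist_commute\<close>)
  moreover have "x \<in> D" using x r by auto
  ultimately show ?thesis using that d r by auto
qed

lemma viscosity_subsolutionD:
  assumes "viscosity_subsolution F D v" "x \<in> D" "C1_on D \<psi> D\<psi>"
    "\<forall>\<^sub>F y in at x within D. v y - \<psi> y \<le> v x - \<psi> x"
  shows "F x (v x) (D\<psi> x) \<le> 0"
  using assms unfolding viscosity_subsolution_def by blast

lemma viscosity_supersolutionD:
  assumes "viscosity_supersolution F S v" "x \<in> S" "C1_on S \<psi> D\<psi>"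
    "\<forall>\<^sub>F y in at x within S. v x - \<psi> x \<le> v y - \<psi> y"
  shows "0 \<le> F x (v x) (D\<psi> x)"
  using assms unfolding viscosity_supersolution_def by blast

lemma viscosity_subsolution_cong:
  assumes "\<And>x. x \<in> D \<Longrightarrow> u x = v x" and "viscosity_subsolution F D v"
  shows "viscosity_subsolution F D u"
  unfolding viscosity_subsolution_def
proof (intro conjI allI ballI impI)
  show "continuous_on D u"
    using assms continuous_on_cong unfolding viscosity_subsolution_def by metis
next
  fix \<psi> D\<psi> x
  assume x: "x \<in> D" "C1_on D \<psi> D\<psi>" "\<forall>\<^sub>F y in at x within D. u y - \<psi> y \<le> u x - \<psi> x"
  then have "\<forall>\<^sub>F y in at x within D. v y - \<psi> y \<le> v x - \<psi> x"
    using assms(1) by (simp add: eventually_at_filter)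
  then show "F x (u x) (D\<psi> x) \<le> 0"
    using viscosity_subsolutionD[OF assms(2) x(1,2)] assms(1)[OF x(1)] by simp
qed

lemma viscosity_supersolution_cong:
  assumes "\<And>x. x \<in> S \<Longrightarrow> u x = v x" and "viscosity_supersolution F S v"
  shows "viscosity_supersolution F S u"
  unfolding viscosity_supersolution_def
proof (intro conjI allI ballI impI)
  show "continuous_on S u"
    using assms continuous_on_cong unfolding viscosity_supersolution_def by metis
next
  fix \<psi> D\<psi> x
  assume x: "x \<in> S" "C1_on S \<psi> D\<psi>" "\<forall>\<^sub>F y in at x within S. u x - \<psi> x \<le> u y - \<psi> y"
  then have "\<forall>\<^sub>F y in at x within S. v x - \<psi> x \<le> v y - \<psi> y"
    using assms(1) by (simp add: eventually_at_filter)
  then show "0 \<le> F x (u x) (D\<psi> x)"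
    using viscosity_supersolutionD[OF assms(2) x(1,2)] assms(1)[OF x(1)] by simp
qed

text \<open>A consequence of \<open>F \<le> 0\<close> that does not mention the gradient holds at
  the dense set of touching points; continuity of \<open>g\<close> extends it to all of
  \<open>D\<close>.\<close>

lemma viscosity_subsolution_pointwise:
  fixes v :: "'a::euclidean_space \<Rightarrow> real"
  assumes D: "open D" and v: "viscosity_subsolution F D v" and g: "continuous_on D g"
    and Fg: "\<And>x p. x \<in> D \<Longrightarrow> F x (v x) p \<le> 0 \<Longrightarrow> g x \<le> 0" and x0: "x0 \<in> D"
  shows "g x0 \<le> (0::real)"
proof (rule ccontr)
  assume "\<not> g x0 \<le> 0"
  then have "open (D \<inter> g -` {0<..})" "x0 \<in> D \<inter> g -` {0<..}"
    using continuous_open_preimage[OF g D] x0 by auto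
  then obtain \<epsilon> where e: "\<epsilon> > 0" "ball x0 \<epsilon> \<subseteq> D \<inter> g -` {0<..}"
    using open_contains_ball by blast
  obtain x \<psi> D\<psi> where x: "x \<in> D" "dist x x0 < \<epsilon>" "C1_on D \<psi> D\<psi>"
    "\<forall>\<^sub>F y in at x within D. v y - \<psi> y \<le> v x - \<psi> x"
    using exists_C1_touching_above[OF D _ x0 e(1), of v] v
    unfolding viscosity_subsolution_def by blast
  then have "F x (v x) (D\<psi> x) \<le> 0"
    using v unfolding viscosity_subsolution_def by blast
  then have "g x \<le> 0" using Fg x by blast
  moreover have "x \<in> ball x0 \<epsilon>" using x by (simp add: dist_commute)
  ultimately show False using e by auto
qed

lemma gderiv_eq_at_local_max:
  fixes f g :: "'a::euclidean_space \<Rightarrow> real"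
  assumes f: "GDERIV f x :> a" and g: "GDERIV g x :> b" and D: "open D" "x \<in> D"
    and max: "\<forall>\<^sub>F y in at x within D. f y - g y \<le> f x - g x"
  shows "a = b"
proof -
  obtain S where S: "open S" "x \<in> S" "\<And>y. y \<in> S \<Longrightarrow> y \<in> D \<Longrightarrow> f y - g y \<le> f x - g x"
    using max unfolding eventually_at_topological by (metis order_refl)
  have "((\<lambda>y. f y - g y) has_derivative (\<lambda>h. h \<bullet> a - h \<bullet> b)) (at x)"
    using f g unfolding gderiv_def by (rule has_derivative_diff)
  then have "(\<lambda>h. h \<bullet> a - h \<bullet> b) = (\<lambda>h. 0)"
    using differential_zero_maxmin[of x "S \<inter> D" "\<lambda>y. f y - g y"] S D by blast
  \<comment> \<open>In the direction \<open>a - b\<close> the vanishing derivative is the squared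
    norm of \<open>a - b\<close>.\<close>
  from fun_cong[OF this, of "a - b"] show ?thesis
    by (simp flip: inner_diff_right)
qed

section \<open>Cubes\<close>

definition cube :: "real \<Rightarrow> 'a::euclidean_space set" where
  "cube t = {x. \<forall>i\<in>Basis. \<bar>x \<bullet> i\<bar> < t}"

lemma cube_eq_box: "cube t = box (- t *\<^sub>R One) (t *\<^sub>R (One::'a::euclidean_space))"
  by (auto simp: cube_def box_def inner_Basis abs_less_iff)

lemma open_cube: "open (cube t)" and bounded_cube: "bounded (cube t)"
  and convex_cube: "convex (cube t)"
  by (simp_all add: cube_eq_box open_box)

lemma zero_in_cube: "t > 0 \<Longrightarrow> 0 \<in> cube t"
  by (simp add: cube_def)

lemma closure_cube: "t > 0 \<Longrightarrow> closure (cube t) = {x::'a::euclidean_space. \<forall>i\<in>Basis. \<bar>x \<bullet> i\<bar> \<le> t}"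
  using zero_in_cube[of t, where 'a='a] unfolding cube_eq_box
  by (subst closure_box) (auto simp: cbox_def abs_le_iff)

lemma dilate_cube:
  assumes "c > 0"
  shows "dilate c (cube 1) = (cube c :: 'a::euclidean_space set)"
proof (intro equalityI subsetI)
  fix x :: 'a assume "x \<in> cube c"
  then have "x = c *\<^sub>R (x /\<^sub>R c)" "x /\<^sub>R c \<in> cube 1"
    using assms by (auto simp: cube_def abs_mult field_simps)
  then show "x \<in> dilate c (cube 1)" unfolding dilate_def by blast
qed (use assms in \<open>auto simp: dilate_def cube_def abs_mult\<close>)

text \<open>A boundary point has a coordinate of modulus at least 1; after dilation by
  \<open>1 + s\<close> this coordinate alone separates it by \<open>s\<close> from the closed cube,
  so \<open>\<kappa> = 1\<close> works.\<close>

lemma strongly_star_shaped_cube: "strongly_star_shaped (cube 1 :: 'a::euclidean_space set)"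
  unfolding strongly_star_shaped_def
proof (intro conjI ballI exI[of _ 1] allI impI)
  show "closed_segment 0 x \<subseteq> cube 1" if "x \<in> cube 1" for x :: 'a
    by (rule closed_segment_subset) (use that in \<open>simp_all add: convex_cube zero_in_cube\<close>)
next
  fix s :: real and x :: 'a
  assume s: "s > 0" and x: "x \<in> dilate (1 + s) (frontier (cube 1))"
  then obtain y where y: "x = (1 + s) *\<^sub>R y" "y \<in> closure (cube 1)" "y \<notin> cube 1"
    by (auto simp: dilate_def frontier_def interior_open[OF open_cube])
  obtain i where i: "i \<in> Basis" "\<bar>y \<bullet> i\<bar> \<ge> 1"
    using y by (auto simp: cube_def not_less)
  have "s \<le> dist x z" if "z \<in> closure (cube 1)" for z
  proof -
    have "\<bar>z \<bullet> i\<bar> \<le> 1" using that i by (simp add: closure_cube)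
    moreover have "\<bar>x \<bullet> i\<bar> \<ge> 1 + s" using i s y by (simp add: abs_mult)
    ultimately have "s \<le> \<bar>(x - z) \<bullet> i\<bar>" by (simp add: inner_diff_left)
    also have "\<dots> \<le> norm (x - z)" using i by (simp add: Basis_le_norm)
    finally show ?thesis by (simp add: dist_norm)
  qed
  moreover have "closure (cube 1 :: 'a set) \<noteq> {}" using zero_in_cube[of 1] by auto
  ultimately show "1 * s \<le> infdist x (closure (cube 1))"
    by (simp add: infdist_notempty cINF_greatest)
qed simp

section \<open>The discounted problem for an eikonal Hamiltonian depending on one coordinate\<close>

text \<open>Allowing \<open>e\<close> to be plus or minus a coordinate vector covers both faces by
  one argument. By \<open>z_le\<close> the derivative of \<open>z\<close> is nonpositive on
  \<open>{-t..t}\<close>, so the linear ODE there is the eikonal equation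
  \<open>\<delta> * z + |z'| = V - V t\<close>. The ODE is required on \<open>{-2<..<2}\<close> to
  have an open neighbourhood of the closed cube.\<close>

locale eikonal_cube =
  fixes e :: "'a::euclidean_space" and V z :: "real \<Rightarrow> real" and t \<delta> :: real
  assumes e: "e \<in> Basis \<or> - e \<in> Basis"
    and t: "0 < t" "t \<le> 1" and \<delta>: "\<delta> > 0"
    and V: "continuous_on UNIV V"
    and z_deriv: "\<And>y. y \<in> {-2<..<2} \<Longrightarrow> (z has_real_derivative \<delta> * z y - (V y - V t)) (at y)"
    and z_t: "z t = 0"
    and z_le: "\<And>y. y \<in> {-t..t} \<Longrightarrow> \<delta> * z y \<le> V y - V t"
    and V_min: "\<And>y. y \<in> {-t..t} \<Longrightarrow> V t \<le> V y"
begin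

text \<open>The discounted cost of walking at unit speed to the face
  \<open>x \<bullet> e = t\<close> and staying there: \<open>V t / \<delta>\<close> is the cost of
  staying on the face forever, \<open>z\<close> the excess paid on the way.\<close>

definition w :: "'a \<Rightarrow> real" where "w x = V t / \<delta> + z (x \<bullet> e)"

text \<open>The gradient of \<open>w\<close>, with the derivative of \<open>z\<close> eliminated
  through the ODE.\<close>

definition Dw :: "'a \<Rightarrow> 'a" where "Dw x = (\<delta> * w x - V (x \<bullet> e)) *\<^sub>R e"

lemma inner_e_e: "e \<bullet> e = 1"
  using e inner_same_Basis[of e] inner_same_Basis[of "- e"] by auto

lemma norm_e: "norm e = 1"
  using inner_e_e by (simp add: norm_eq_1)

lemma inner_e_cube: "x \<in> cube t \<Longrightarrow> \<bar>x \<bullet> e\<bar> < t"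
  using e by (auto simp: cube_def dest: bspec[of _ _ e] bspec[of _ _ "- e"])

lemma inner_e_closure: "x \<in> closure (cube t) \<Longrightarrow> \<bar>x \<bullet> e\<bar> \<le> t"
  using e by (auto simp: closure_cube[OF t(1)] dest: bspec[of _ _ e] bspec[of _ _ "- e"])

lemma inner_e_Basis:
  assumes "i \<in> Basis" shows "i = e \<or> i = - e \<or> e \<bullet> i = 0"
  using e inner_Basis[OF _ assms, of e] inner_Basis[OF _ assms, of "- e"] by (auto split: if_splits)

lemma norm_ge_minus_inner_e: "- (p \<bullet> e) \<le> norm p"
  using Cauchy_Schwarz_ineq2[of p e] norm_e by simp

lemma w_gderiv:
  assumes "\<bar>x \<bullet> e\<bar> < 2" shows "GDERIV w x :> Dw x"
proof -
  have "((\<lambda>x. z (x \<bullet> e)) has_derivative (\<lambda>h. (h \<bullet> e) * (\<delta> * z (x \<bullet> e) - (V (x \<bullet> e) - V t)))) (at x)"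
    by (rule has_derivative_compose[where g=z and f="\<lambda>x. x \<bullet> e", THEN has_derivative_eq_rhs,
          OF _ z_deriv[unfolded has_field_derivative_def]])
      (use assms in \<open>auto intro!: derivative_eq_intros\<close>)
  then show ?thesis
    unfolding gderiv_def w_def Dw_def using \<delta>
    by (auto intro!: derivative_eq_intros simp: field_simps)
qed

lemma continuous_on_V_inner: "continuous_on S (\<lambda>x. V (x \<bullet> e))"
  by (rule continuous_on_compose2[OF V]) (auto intro!: continuous_intros)

lemma C1_w: "S \<subseteq> {x. \<bar>x \<bullet> e\<bar> < 2} \<Longrightarrow> C1_on S w Dw"
  unfolding C1_on_def
proof (intro exI conjI ballI)
  let ?W = "{x::'a. \<bar>x \<bullet> e\<bar> < 2}"
  show "open ?W" by (intro open_Collect_less continuous_intros)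
  show "GDERIV w x :> Dw x" if "x \<in> ?W" for x using w_gderiv that by simp
  then have "continuous_on ?W w"
    by (intro continuous_at_imp_continuous_on)
      (auto simp: gderiv_def dest!: has_derivative_continuous)
  moreover have "continuous_on ?W (\<lambda>x. V (x \<bullet> e))" by (rule continuous_on_V_inner)
  ultimately show "continuous_on ?W Dw"
    unfolding Dw_def by (intro continuous_intros)
qed simp_all

lemma closure_cube_slab: "closure (cube t) \<subseteq> {x. \<bar>x \<bullet> e\<bar> < 2}"
  using inner_e_closure t by fastforce

lemma cube_slab: "cube t \<subseteq> {x. \<bar>x \<bullet> e\<bar> < 2}"
  using closure_cube_slab closure_subset by blast

lemma continuous_on_w: "continuous_on (closure (cube t)) w"
proof (intro continuous_at_imp_continuous_on ballI)
  fix x :: 'a assume "x \<in> closure (cube t)"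
  then have "GDERIV w x :> Dw x" using closure_cube_slab by (auto intro: w_gderiv)
  then show "isCont w x" by (auto simp: gderiv_def dest!: has_derivative_continuous)
qed

lemma w_le: "x \<in> closure (cube t) \<Longrightarrow> \<delta> * w x \<le> V (x \<bullet> e)"
  using inner_e_closure[of x] z_le[of "x \<bullet> e"] \<delta> by (simp add: w_def distrib_left abs_le_iff)

text \<open>The sign in \<open>w_le\<close> resolves the absolute value, so \<open>w\<close>
  satisfies the equation classically up to the boundary.\<close>

lemma norm_Dw: "x \<in> closure (cube t) \<Longrightarrow> norm (Dw x) = V (x \<bullet> e) - \<delta> * w x"
  using w_le[of x] norm_e by (simp add: Dw_def)

section \<open>The explicit function \<open>w\<close> is a state-constraint solution\<close>

lemma w_subsolution: "viscosity_subsolution (\<lambda>x u p. \<delta> * u + (norm p - V (x \<bullet> e))) (cube t) w"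
  unfolding viscosity_subsolution_def
proof (intro conjI allI ballI impI)
  show "continuous_on (cube t) w"
    using continuous_on_w closure_subset continuous_on_subset by blast
next
  fix \<psi> D\<psi> x
  assume x: "x \<in> cube t" and \<psi>: "C1_on (cube t) \<psi> D\<psi>"
    and max: "\<forall>\<^sub>F y in at x within cube t. w y - \<psi> y \<le> w x - \<psi> x"
  have "GDERIV \<psi> x :> D\<psi> x" using \<psi> x unfolding C1_on_def by blast
  moreover have "GDERIV w x :> Dw x" using x cube_slab by (auto intro: w_gderiv)
  ultimately have "D\<psi> x = Dw x"
    using gderiv_eq_at_local_max[OF _ _ open_cube x max] by metis
  then show "\<delta> * w x + (norm (D\<psi> x) - V (x \<bullet> e)) \<le> 0"
    using norm_Dw[of x] x closure_subset[of "cube t"] by auto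
qed

lemma closure_cube_shift:
  assumes x: "x \<in> closure (cube t)" and h: "0 \<le> h" "x \<bullet> e + h \<le> t"
  shows "x + h *\<^sub>R e \<in> closure (cube t)"
  unfolding closure_cube[OF t(1)]
proof (intro CollectI ballI)
  fix i :: 'a assume i: "i \<in> Basis"
  have xi: "\<bar>x \<bullet> i\<bar> \<le> t" using x i closure_cube[OF t(1)] by blast
  have "\<bar>x \<bullet> e + h\<bar> \<le> t" using inner_e_closure[OF x] h by auto
  then show "\<bar>(x + h *\<^sub>R e) \<bullet> i\<bar> \<le> t"
    using inner_e_Basis[OF i] xi inner_e_e
    by (auto simp: inner_add_left)
qed

text \<open>On the face \<open>x \<bullet> e = t\<close> the inequality holds for every gradient
  because \<open>\<delta> * w x = V t\<close>. At all other points, lateral faces included, the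
  direction \<open>e\<close> stays inside the closed cube, and the one-sided derivative along it
  bounds \<open>D\<psi> x \<bullet> e\<close> from above.\<close>

lemma w_supersolution:
  "viscosity_supersolution (\<lambda>x u p. \<delta> * u + (norm p - V (x \<bullet> e))) (closure (cube t)) w"
  unfolding viscosity_supersolution_def
proof (intro conjI allI ballI impI)
  show "continuous_on (closure (cube t)) w" by (rule continuous_on_w)
next
  fix \<psi> D\<psi> x
  assume x: "x \<in> closure (cube t)" and \<psi>: "C1_on (closure (cube t)) \<psi> D\<psi>"
    and min: "\<forall>\<^sub>F y in at x within closure (cube t). w x - \<psi> x \<le> w y - \<psi> y"
  show "0 \<le> \<delta> * w x + (norm (D\<psi> x) - V (x \<bullet> e))"
  proof (cases "x \<bullet> e = t")
    case True
    then show ?thesis using \<delta> by (simp add: w_def z_t)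
  next
    case False
    then have xt: "x \<bullet> e < t" using inner_e_closure[OF x] by simp
    have g\<psi>: "GDERIV \<psi> x :> D\<psi> x" using \<psi> x unfolding C1_on_def by blast
    have gw: "GDERIV w x :> Dw x" using x closure_cube_slab by (auto intro: w_gderiv)
    define k where "k h = w (x + h *\<^sub>R e) - \<psi> (x + h *\<^sub>R e)" for h
    have d: "((\<lambda>x. w x - \<psi> x) has_derivative (\<lambda>h. h \<bullet> Dw x - h \<bullet> D\<psi> x)) (at (x + 0 *\<^sub>R e))"
      using gw g\<psi> by (auto simp: gderiv_def intro: has_derivative_diff)
    have "(k has_derivative (\<lambda>h. (h *\<^sub>R e) \<bullet> Dw x - (h *\<^sub>R e) \<bullet> D\<psi> x)) (at 0)"
      unfolding k_def
      by (rule has_derivative_compose[where f="\<lambda>h. x + h *\<^sub>R e", OF _ d]) (auto intro!: derivative_eq_intros)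
    then have dk: "(k has_real_derivative (e \<bullet> Dw x - e \<bullet> D\<psi> x)) (at 0)"
      unfolding has_field_derivative_def
      by (rule has_derivative_eq_rhs) (auto simp: algebra_simps)
    obtain r where r: "r > 0"
      "\<And>y. y \<in> closure (cube t) \<Longrightarrow> y \<noteq> x \<Longrightarrow> dist y x < r \<Longrightarrow> w x - \<psi> x \<le> w y - \<psi> y"
      using min unfolding eventually_at by blast
    have "e \<bullet> Dw x - e \<bullet> D\<psi> x \<ge> 0"
    proof (rule ccontr)
      assume "\<not> e \<bullet> Dw x - e \<bullet> D\<psi> x \<ge> 0"
      then obtain d where d: "d > 0" "\<And>h. 0 < h \<Longrightarrow> h < d \<Longrightarrow> k h < k 0"
        using DERIV_neg_dec_right[OF dk] by auto
      \<comment> \<open>The three bounds keep \<open>h\<close> in the range where \<open>k\<close>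
        has dropped, in the neighbourhood of minimality, and in the closed cube.\<close>
      define h where "h = min (d/2) (min (r/2) (t - x \<bullet> e))"
      have h: "0 < h" "h < d" "h < r" "x \<bullet> e + h \<le> t" using d r xt by (auto simp: h_def)
      have "x + h *\<^sub>R e \<in> closure (cube t)" using closure_cube_shift[OF x] h by simp
      then have "k 0 \<le> k h"
        using r(2)[of "x + h *\<^sub>R e"] h norm_e by (cases "e = 0") (auto simp: k_def dist_norm)
      then show False using d(2)[of h] h by simp
    qed
    then have "D\<psi> x \<bullet> e \<le> \<delta> * w x - V (x \<bullet> e)"
      by (simp add: Dw_def inner_e_e inner_commute)
    then show ?thesis using norm_ge_minus_inner_e[of "D\<psi> x"] by linarith
  qed
qed

section \<open>Comparison of sub- and supersolutions with \<open>w\<close>\<close>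

lemma supersolution_ge_w:
  assumes v: "viscosity_supersolution (\<lambda>x u p. \<delta> * u + (norm p - V (x \<bullet> e))) (closure (cube t)) v"
    and x: "x \<in> closure (cube t)"
  shows "w x \<le> v x"
proof -
  have cv: "continuous_on (closure (cube t)) v"
    using v unfolding viscosity_supersolution_def by blast
  have "compact (closure (cube t :: 'a set))" using bounded_cube by (simp add: compact_closure)
  moreover have "continuous_on (closure (cube t)) (\<lambda>x. v x - w x)"
    by (intro continuous_intros cv continuous_on_w)
  ultimately obtain m where m: "m \<in> closure (cube t)"
    "\<And>y. y \<in> closure (cube t) \<Longrightarrow> v m - w m \<le> v y - w y"
    using continuous_attains_inf[of "closure (cube t)" "\<lambda>x. v x - w x"] x
    by (metis empty_iff)
  \<comment> \<open>Being continuously differentiable up to the boundary, \<open>w\<close> is itself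
    a test function for \<open>v\<close> at the minimum point \<open>m\<close>.\<close>
  have "\<forall>\<^sub>F y in at m within closure (cube t). v m - w m \<le> v y - w y"
    unfolding eventually_at using m by (intro exI[of _ 1]) auto
  then have "0 \<le> \<delta> * v m + (norm (Dw m) - V (m \<bullet> e))"
    by (rule viscosity_supersolutionD[OF v m(1) C1_w[OF closure_cube_slab]])
  then have "w m \<le> v m" using norm_Dw[OF m(1)] \<delta> by simp
  then show ?thesis using m(2)[OF x] by simp
qed

text \<open>Dropping the nonnegative \<open>norm p\<close> leaves a pointwise bound in the cube, and
  continuity carries it to the boundary. On the face \<open>x \<bullet> e = t\<close> it serves as
  the boundary condition of the comparison.\<close>

lemma subsolution_le_cost:
  assumes v: "viscosity_subsolution (\<lambda>x u p. \<delta> * u + (norm p - V (x \<bullet> e))) (cube t) v"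
    and cv: "continuous_on (closure (cube t)) v" and x: "x \<in> closure (cube t)"
  shows "\<delta> * v x \<le> V (x \<bullet> e)"
proof -
  have c: "continuous_on (closure (cube t)) (\<lambda>x. \<delta> * v x - V (x \<bullet> e))"
    by (intro continuous_intros cv continuous_on_V_inner)
  have "\<delta> * v y - V (y \<bullet> e) \<le> 0" if y: "y \<in> cube t" for y
  proof (rule viscosity_subsolution_pointwise[OF open_cube v _ _ y])
    show "continuous_on (cube t) (\<lambda>x. \<delta> * v x - V (x \<bullet> e))"
      by (rule continuous_on_subset[OF c closure_subset])
    show "\<delta> * v x - V (x \<bullet> e) \<le> 0" if "\<delta> * v x + (norm p - V (x \<bullet> e)) \<le> 0" for x p
      using that norm_ge_zero[of p] by linarith
  qed
  then have "\<delta> * v x - V (x \<bullet> e) \<le> 0"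
    by (rule continuous_le_on_closure[OF c x])
  then show ?thesis by simp
qed

text \<open>The squared length of the component orthogonal to \<open>e\<close>, written as a
  polynomial for easy differentiation.\<close>

definition perp2 :: "'a \<Rightarrow> real" where "perp2 a = a \<bullet> a - (a \<bullet> e)\<^sup>2"

lemma perp2_eq: "perp2 a = (norm (a - (a \<bullet> e) *\<^sub>R e))\<^sup>2"
  unfolding power2_norm_eq_inner
  by (simp add: perp2_def inner_diff_left inner_diff_right inner_e_e inner_commute power2_eq_square)

text \<open>A thin cylinder around the ray from \<open>x0\<close> in direction \<open>e\<close>
  leaves the cube only through the face \<open>x \<bullet> e = t\<close>: the room
  \<open>\<rho>\<close> that \<open>x0\<close> has in each coordinate is preserved in the
  coordinates orthogonal to \<open>e\<close>.\<close>

lemma cylinder_in_cube: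
  assumes x0: "x0 \<in> cube t"
  obtains \<rho> where "\<rho> > 0"
    "\<And>x. x0 \<bullet> e - \<rho> \<le> x \<bullet> e \<Longrightarrow> x \<bullet> e < t \<Longrightarrow> perp2 (x - x0) \<le> \<rho>\<^sup>2 \<Longrightarrow> x \<in> cube t"
proof -
  obtain \<rho> where \<rho>: "\<rho> > 0" "cball x0 \<rho> \<subseteq> cube t"
    using open_contains_cball open_cube x0 by metis
  have bound: "\<bar>x0 \<bullet> i\<bar> + \<rho> < t" if i: "i \<in> Basis" for i
  proof -
    have "x0 + \<rho> *\<^sub>R i \<in> cball x0 \<rho>" "x0 - \<rho> *\<^sub>R i \<in> cball x0 \<rho>"
      using \<rho>(1) i by (auto simp: dist_norm)
    then have "\<bar>(x0 + \<rho> *\<^sub>R i) \<bullet> i\<bar> < t" "\<bar>(x0 - \<rho> *\<^sub>R i) \<bullet> i\<bar> < t"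
      using \<rho>(2) i unfolding cube_def by blast+
    then show ?thesis using i by (simp add: inner_add_left inner_diff_left)
  qed
  have "x \<in> cube t"
    if x: "x0 \<bullet> e - \<rho> \<le> x \<bullet> e" "x \<bullet> e < t" "perp2 (x - x0) \<le> \<rho>\<^sup>2" for x
    unfolding cube_def
  proof (intro CollectI ballI)
    fix i :: 'a assume i: "i \<in> Basis"
    consider "i = e \<or> i = - e" | "e \<bullet> i = 0" using inner_e_Basis[OF i] by blast
    then show "\<bar>x \<bullet> i\<bar> < t"
    proof cases
      case 1
      then show ?thesis using bound[OF i] x by auto
    next
      case 2
      define a where "a = x - x0"
      have "\<bar>a \<bullet> i\<bar> = \<bar>(a - (a \<bullet> e) *\<^sub>R e) \<bullet> i\<bar>" using 2 by (simp add: inner_diff_left)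
      also have "\<dots> \<le> norm (a - (a \<bullet> e) *\<^sub>R e)" using i by (simp add: Basis_le_norm)
      also have "\<dots> \<le> \<rho>"
        by (rule power2_le_imp_le) (use x(3) \<rho>(1) in \<open>simp_all add: perp2_eq a_def\<close>)
      finally show ?thesis using bound[OF i] by (simp add: a_def inner_diff_left)
    qed
  qed
  then show ?thesis using that \<rho>(1) by blast
qed

text \<open>A penalty that is nonincreasing in direction \<open>e\<close> can be added to \<open>w\<close> without destroying the
  supersolution inequality; it keeps the maximum away from all faces of the cube except
  \<open>x \<bullet> e = t\<close>, where a subsolution is bounded by the cost of standing still.\<close>

lemma subsolution_le_w:
  assumes v: "viscosity_subsolution (\<lambda>x u p. \<delta> * u + (norm p - V (x \<bullet> e))) (cube t) v"
    and cv: "continuous_on (closure (cube t)) v" and x0: "x0 \<in> cube t"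
  shows "v x0 \<le> w x0"
proof (rule field_le_epsilon)
  fix \<epsilon> :: real assume \<epsilon>: "\<epsilon> > 0"
  let ?C = "closure (cube t) :: 'a set"
  obtain \<rho> where \<rho>: "\<rho> > 0"
    "\<And>x. x0 \<bullet> e - \<rho> \<le> x \<bullet> e \<Longrightarrow> x \<bullet> e < t \<Longrightarrow> perp2 (x - x0) \<le> \<rho>\<^sup>2 \<Longrightarrow> x \<in> cube t"
    using cylinder_in_cube[OF x0] by metis
  have C: "compact ?C" using bounded_cube by (simp add: compact_closure)
  have "bounded ((\<lambda>x. v x - w x) ` ?C)"
    by (intro compact_imp_bounded compact_continuous_image continuous_intros cv continuous_on_w C)
  then obtain M where M: "M > 0" "\<And>x. x \<in> ?C \<Longrightarrow> \<bar>v x - w x\<bar> \<le> M"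
    by (auto simp: bounded_pos)
  \<comment> \<open>The first entry makes the penalty at least \<open>M\<close> on the lateral wall
    of the cylinder. The second does so on its bottom, where the exponential is at least
    \<open>exp (K * \<rho>)\<close>, hence at least \<open>K * \<rho>\<close>.\<close>
  define K where "K = max (M / \<rho>\<^sup>2) (M / (\<epsilon> * \<rho>))"
  have K: "K > 0" "K * \<rho>\<^sup>2 \<ge> M" "\<epsilon> * (K * \<rho>) \<ge> M"
  proof -
    have "K \<ge> M / \<rho>\<^sup>2" "K \<ge> M / (\<epsilon> * \<rho>)" by (simp_all add: K_def)
    then show "K * \<rho>\<^sup>2 \<ge> M" "\<epsilon> * (K * \<rho>) \<ge> M"
      using \<rho> \<epsilon> by (auto simp: field_simps)
    show "K > 0" using M \<rho> by (simp add: K_def less_max_iff_disj)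
  qed
  define pen where "pen x = \<epsilon> * exp (- K * ((x - x0) \<bullet> e)) + K * perp2 (x - x0)" for x
  define D\<psi> where "D\<psi> x = Dw x + (- \<epsilon> * K * exp (- K * ((x - x0) \<bullet> e))) *\<^sub>R e
      + (2 * K) *\<^sub>R ((x - x0) - ((x - x0) \<bullet> e) *\<^sub>R e)" for x
  \<comment> \<open>The closed cylinder around the ray; its only part on the boundary of the cube is
    on the face \<open>x \<bullet> e = t\<close>.\<close>
  define Q where "Q = ?C \<inter> {x. x0 \<bullet> e - \<rho> \<le> x \<bullet> e} \<inter> {x. perp2 (x - x0) \<le> \<rho>\<^sup>2}"
  have "compact Q"
    unfolding Q_def perp2_def
    by (intro compact_Int_closed C closed_Collect_le continuous_intros)
  moreover have x0Q: "x0 \<in> Q"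
    using x0 closure_subset \<rho>(1) by (auto simp: Q_def perp2_def)
  moreover have "continuous_on Q (\<lambda>x. v x - (w x + pen x))"
    unfolding pen_def perp2_def
    by (intro continuous_intros continuous_on_subset[OF cv] continuous_on_subset[OF continuous_on_w])
      (auto simp: Q_def)
  ultimately obtain m where m: "m \<in> Q"
    "\<And>y. y \<in> Q \<Longrightarrow> v y - (w y + pen y) \<le> v m - (w m + pen m)"
    using continuous_attains_sup[of Q "\<lambda>x. v x - (w x + pen x)"] by (metis empty_iff)
  have mC: "m \<in> ?C" using m by (simp add: Q_def)
  have "v m - (w m + pen m) \<le> 0"
  proof (rule ccontr)
    assume "\<not> v m - (w m + pen m) \<le> 0"
    then have gt: "w m + pen m < v m" by simp
    have perp: "perp2 (m - x0) \<ge> 0" by (simp add: perp2_eq)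
    have exp: "\<epsilon> * exp (- K * ((m - x0) \<bullet> e)) > 0" using \<epsilon> by simp
    have pM: "pen m < M" using gt M(2)[OF mC] by simp
    have "0 \<le> K * perp2 (m - x0)" using perp K by simp
    then have pen0: "pen m > 0" using exp by (simp add: pen_def)
    have "K * perp2 (m - x0) < K * \<rho>\<^sup>2" using pM exp K(2) unfolding pen_def by linarith
    then have q: "perp2 (m - x0) < \<rho>\<^sup>2" using K by simp
    have left: "x0 \<bullet> e - \<rho> < m \<bullet> e"
    proof (rule ccontr)
      assume "\<not> x0 \<bullet> e - \<rho> < m \<bullet> e"
      then have "K * \<rho> \<le> K * - ((m - x0) \<bullet> e)"
        using K by (intro mult_left_mono) (auto simp: inner_diff_left)
      then have "- K * ((m - x0) \<bullet> e) \<ge> K * \<rho>" by simp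
      then have "exp (- K * ((m - x0) \<bullet> e)) \<ge> exp (K * \<rho>)" by simp
      moreover have "exp (K * \<rho>) \<ge> 1 + K * \<rho>" by (rule exp_ge_add_one_self)
      ultimately have "K * \<rho> \<le> exp (- K * ((m - x0) \<bullet> e))" by linarith
      then have "\<epsilon> * exp (- K * ((m - x0) \<bullet> e)) \<ge> \<epsilon> * (K * \<rho>)"
        using \<epsilon> by (intro mult_left_mono) auto
      then show False using pM K \<open>0 \<le> K * perp2 (m - x0)\<close> by (simp add: pen_def)
    qed
    show False
    proof (cases "m \<bullet> e = t")
      case True
      \<comment> \<open>On this face the cost of standing still is \<open>V t\<close>, which is
        exactly \<open>\<delta> * w m\<close>.\<close>
      have "\<delta> * v m \<le> \<delta> * w m"
        using subsolution_le_cost[OF v cv mC] True \<delta> by (simp add: w_def z_t)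
      then show ?thesis using gt pen0 \<delta> by simp
    next
      case False
      then have "m \<bullet> e < t" using inner_e_closure[OF mC] by simp
      then have mD: "m \<in> cube t" using \<rho>(2)[of m] left q by simp
      let ?N = "{y. x0 \<bullet> e - \<rho> < y \<bullet> e} \<inter> {y. perp2 (y - x0) < \<rho>\<^sup>2}"
      have "open ?N"
        unfolding perp2_def by (intro open_Int open_Collect_less continuous_intros)
      then have max: "\<forall>\<^sub>F y in at m within cube t. v y - (w y + pen y) \<le> v m - (w m + pen m)"
        unfolding eventually_at_topological
        by (intro exI[of _ ?N] conjI ballI impI m(2))
          (use left q closure_subset[of "cube t :: 'a set"] in \<open>auto simp: Q_def\<close>)
      have C1: "C1_on (cube t) (\<lambda>x. w x + pen x) D\<psi>"
      proof -
        obtain W where W: "open W" "cube t \<subseteq> W" "\<And>x. x \<in> W \<Longrightarrow> GDERIV w x :> Dw x"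
          "continuous_on W Dw"
          using C1_w[OF cube_slab] unfolding C1_on_def by blast
        have "GDERIV (\<lambda>x. w x + pen x) x :> D\<psi> x" if "x \<in> W" for x
          using W(3)[OF that] unfolding gderiv_def D\<psi>_def pen_def perp2_def
          by (auto intro!: derivative_eq_intros simp: inner_commute algebra_simps power2_eq_square)
        moreover have "continuous_on W D\<psi>"
          unfolding D\<psi>_def by (intro continuous_intros W(4))
        ultimately show ?thesis using W unfolding C1_on_def by blast
      qed
      have "\<delta> * v m + (norm (D\<psi> m) - V (m \<bullet> e)) \<le> 0"
        by (rule viscosity_subsolutionD[OF v mD C1 max])
      \<comment> \<open>The gradient of the \<open>perp2\<close> term is orthogonal to
        \<open>e\<close>, and the exponential only lowers the component along \<open>e\<close>. As
        the norm dominates minus this component, the penalty works in favour of the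
        inequality.\<close>
      moreover have "D\<psi> m \<bullet> e = \<delta> * w m - V (m \<bullet> e) - K * (\<epsilon> * exp (- K * ((m - x0) \<bullet> e)))"
        by (simp add: D\<psi>_def Dw_def inner_add_left inner_diff_left inner_e_e)
      moreover have "0 < K * (\<epsilon> * exp (- K * ((m - x0) \<bullet> e)))" using K exp by simp
      ultimately have "\<delta> * v m \<le> \<delta> * w m"
        using norm_ge_minus_inner_e[of "D\<psi> m"] by linarith
      then show False using gt pen0 \<delta> by simp
    qed
  qed
  then have "v x0 - (w x0 + pen x0) \<le> 0" using m(2)[OF x0Q] by linarith
  \<comment> \<open>The penalty at \<open>x0\<close> is exactly \<open>\<epsilon>\<close>.\<close>
  then show "v x0 \<le> w x0 + \<epsilon>" by (simp add: pen_def perp2_def)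
qed

section \<open>Uniqueness, the additive eigenvalue and the normalised solution\<close>

lemma state_constraint_solution_eq_w:
  assumes v: "state_constraint_solution \<delta> (\<lambda>x p. norm p - V (x \<bullet> e)) (cube t) v"
    and x: "x \<in> closure (cube t)"
  shows "v x = w x"
proof (rule antisym)
  have cv: "continuous_on (closure (cube t)) v"
    using v unfolding state_constraint_solution_def by blast
  then have "continuous_on (closure (cube t)) (\<lambda>x. v x - w x)"
    by (intro continuous_intros continuous_on_w)
  then have "v x - w x \<le> 0"
    by (rule continuous_le_on_closure[OF _ x])
      (use v subsolution_le_w cv in \<open>auto simp: state_constraint_solution_def\<close>)
  then show "v x \<le> w x" by simp
  show "w x \<le> v x"
    using supersolution_ge_w[OF _ x] v unfolding state_constraint_solution_def by blast
qed

lemma the_state_constraint_solution_eq: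
  assumes x: "x \<in> closure (cube t)"
  shows "the_state_constraint_solution \<delta> (\<lambda>x p. norm p - V (x \<bullet> e)) (cube t) x = w x"
proof -
  \<comment> \<open>Outside the closed cube the value 0 is the one fixed by
    \<open>the_state_constraint_solution\<close>.\<close>
  define u where "u x = (if x \<in> closure (cube t) then w x else 0)" for x :: 'a
  have "state_constraint_solution \<delta> (\<lambda>x p. norm p - V (x \<bullet> e)) (cube t) u"
    unfolding state_constraint_solution_def
  proof (intro conjI)
    show "continuous_on (closure (cube t)) u"
      using continuous_on_w by (rule continuous_on_eq) (simp add: u_def)
    show "viscosity_subsolution (\<lambda>x z p. \<delta> * z + (norm p - V (x \<bullet> e))) (cube t) u"
      by (rule viscosity_subsolution_cong[OF _ w_subsolution])
        (use closure_subset[of "cube t"] in \<open>auto simp: u_def\<close>)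
    show "viscosity_supersolution (\<lambda>x z p. \<delta> * z + (norm p - V (x \<bullet> e))) (closure (cube t)) u"
      by (rule viscosity_supersolution_cong[OF _ w_supersolution]) (simp add: u_def)
  qed
  then have "the_state_constraint_solution \<delta> (\<lambda>x p. norm p - V (x \<bullet> e)) (cube t) = u"
    unfolding the_state_constraint_solution_def
    by (intro the_equality conjI ext)
      (auto simp: u_def dest: state_constraint_solution_eq_w)
  then show ?thesis using x by (simp add: u_def)
qed

text \<open>Constants are subsolutions at level \<open>- V t\<close> because \<open>V t\<close> is
  the minimum. Conversely \<open>norm p \<ge> 0\<close> forces \<open>- V \<le> c\<close> in the
  cube and, by continuity, on the face where the minimum is attained.\<close>

lemma additive_eigenvalue_eq: "additive_eigenvalue (\<lambda>x p. norm p - V (x \<bullet> e)) (cube t) = - V t"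
  unfolding additive_eigenvalue_def
proof (rule cInf_eq_minimum)
  let ?F = "\<lambda>c x (z::real) p. norm p - V (x \<bullet> e) - c"
  have "viscosity_subsolution (?F (- V t)) (cube t) (\<lambda>x. 0)"
    unfolding viscosity_subsolution_def
  proof (intro conjI allI ballI impI)
    fix \<psi> D\<psi> and x :: 'a
    assume x: "x \<in> cube t" and \<psi>: "C1_on (cube t) \<psi> D\<psi>"
      and max: "\<forall>\<^sub>F y in at x within cube t. 0 - \<psi> y \<le> 0 - \<psi> x"
    have "GDERIV \<psi> x :> D\<psi> x" using \<psi> x unfolding C1_on_def by blast
    then have "D\<psi> x = 0"
      using gderiv_eq_at_local_max[OF GDERIV_const _ open_cube x max] by metis
    then show "norm (D\<psi> x) - V (x \<bullet> e) - - V t \<le> 0"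
      using V_min[of "x \<bullet> e"] inner_e_cube[OF x] by (simp add: abs_less_iff)
  qed simp
  then show "- V t \<in> {c. \<exists>v. viscosity_subsolution (?F c) (cube t) v}" by blast
  fix c assume "c \<in> {c. \<exists>v. viscosity_subsolution (?F c) (cube t) v}"
  then obtain v where v: "viscosity_subsolution (?F c) (cube t) v" by blast
  have le: "- V (y \<bullet> e) - c \<le> 0" if y: "y \<in> cube t" for y
  proof (rule viscosity_subsolution_pointwise[OF open_cube v _ _ y])
    show "continuous_on (cube t) (\<lambda>y. - V (y \<bullet> e) - c)"
      by (intro continuous_intros continuous_on_V_inner)
    show "- V (x \<bullet> e) - c \<le> 0" if "norm p - V (x \<bullet> e) - c \<le> 0" for x p
      using that norm_ge_zero[of p] by linarith
  qed
  have mem: "t *\<^sub>R e \<in> closure (cube t)"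
    using closure_cube_shift[of 0 t] t zero_in_cube[OF t(1)] closure_subset[of "cube t :: 'a set"] by auto
  have "continuous_on (closure (cube t)) (\<lambda>y. - V (y \<bullet> e) - c)"
    by (intro continuous_intros continuous_on_V_inner)
  from continuous_le_on_closure[OF this mem le] have "- V (t *\<^sub>R e \<bullet> e) - c \<le> 0" .
  then show "- V t \<le> c" by (simp add: inner_e_e)
qed

text \<open>The eigenvalue term cancels the constant \<open>V t / \<delta>\<close> of
  \<open>w\<close>.\<close>

lemma normalized_solution_eq:
  assumes "x \<in> closure (cube t)"
  shows "the_state_constraint_solution \<delta> (\<lambda>x p. norm p - V (x \<bullet> e)) (cube t) x
    + additive_eigenvalue (\<lambda>x p. norm p - V (x \<bullet> e)) (cube t) / \<delta> = z (x \<bullet> e)"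
  by (simp add: the_state_constraint_solution_eq[OF assms] additive_eigenvalue_eq w_def)

end

text \<open>Variation of constants: \<open>z y\<close> is the integral of
  \<open>exp (- \<delta> * (s - y)) * (V s - V t)\<close> over \<open>s\<close> from
  \<open>y\<close> to \<open>t\<close>. For \<open>y\<close> in \<open>{-t..t}\<close> the integrand
  lies between 0 and \<open>A\<close>, whence both bounds.\<close>

lemma discounted_profile_exists:
  fixes V :: "real \<Rightarrow> real"
  assumes V: "continuous_on UNIV V" and t: "0 < t" "t \<le> 1" and \<delta>: "\<delta> > 0"
    and lower: "\<And>y. y \<in> {-t..t} \<Longrightarrow> V t \<le> V y"
    and upper: "\<And>y. y \<in> {-t..t} \<Longrightarrow> V y - V t \<le> A"
  obtains z where
    "\<And>y. y \<in> {-2<..<2} \<Longrightarrow> (z has_real_derivative \<delta> * z y - (V y - V t)) (at y)"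
    "z t = 0" "\<And>y. y \<in> {-t..t} \<Longrightarrow> 0 \<le> z y" "\<And>y. y \<in> {-t..t} \<Longrightarrow> z y \<le> A * (t - y)"
proof -
  let ?f = "\<lambda>y. exp (- \<delta> * y) * (V y - V t)"
  have "continuous_on {-2..2} ?f"
    by (intro continuous_intros continuous_on_subset[OF V]) auto
  then obtain F where "\<And>y. y \<in> {-2..2} \<Longrightarrow> (F has_vector_derivative ?f y) (at y within {-2..2})"
    using antiderivative_continuous[of "-2" 2 ?f] by blast
  then have F: "(F has_real_derivative ?f y) (at y)" if "y \<in> {-2<..<2}" for y
    using that at_within_Icc_at[of "-2" y 2]
    unfolding has_real_derivative_iff_has_vector_derivative by (metis atLeastAtMost_iff
        greaterThanLessThan_iff less_imp_le)
  define z where "z y = exp (\<delta> * y) * (F t - F y)" for y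
  have "(z has_real_derivative \<delta> * z y - (V y - V t)) (at y)" if "y \<in> {-2<..<2}" for y
  proof -
    have "exp (\<delta> * y) * exp (- (\<delta> * y)) = 1" by (simp flip: exp_add)
    then show ?thesis
      unfolding z_def using F[OF that]
      by (auto intro!: derivative_eq_intros simp: algebra_simps)
  qed
  moreover have "z t = 0" by (simp add: z_def)
  moreover have "0 \<le> z y \<and> z y \<le> A * (t - y)" if y: "y \<in> {-t..t}" for y
  proof (cases "y = t")
    case False
    then have "y < t" using y by simp
    \<comment> \<open>The mean value theorem for the antiderivative stands in for an estimate of the
      integral.\<close>
    then obtain \<xi> where \<xi>: "y < \<xi>" "\<xi> < t" "F t - F y = (t - y) * ?f \<xi>"
      using MVT2[of y t F ?f] F y t by auto
    have b: "0 \<le> V \<xi> - V t" "V \<xi> - V t \<le> A"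
      using lower[of \<xi>] upper[of \<xi>] \<xi> y by auto
    have "z y = exp (\<delta> * y - \<delta> * \<xi>) * ((t - y) * (V \<xi> - V t))"
      by (simp add: z_def \<xi> exp_diff exp_minus field_simps)
    moreover have "exp (\<delta> * y - \<delta> * \<xi>) \<le> 1" using \<xi> \<delta> by simp
    moreover have "0 \<le> (t - y) * (V \<xi> - V t)" "(t - y) * (V \<xi> - V t) \<le> (t - y) * A"
      using b \<open>y < t\<close> by (auto intro: mult_left_mono)
    ultimately show ?thesis
      using mult_right_mono[of "exp (\<delta> * y - \<delta> * \<xi>)" 1 "(t - y) * (V \<xi> - V t)"]
      by (auto simp: mult.commute)
  qed (simp add: z_def)
  ultimately show ?thesis using that by blast
qed

section \<open>The oscillating potential\<close>

text \<open>The sign changes infinitely often as \<open>s\<close> decreases to 0, while the factor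
  \<open>s\<^sup>2\<close> keeps the function Lipschitz; 1/16 makes the Lipschitz constant on
  \<open>{0..1}\<close> at most 1/2.\<close>

definition osc :: "real \<Rightarrow> real" where "osc s = s\<^sup>2 * sin (pi / s) / 16"

definition ramp :: "real \<Rightarrow> real" where "ramp y = max 0 (min 1 (1 - y))"

text \<open>On \<open>{-1..1}\<close> the first three terms give \<open>1 - |y|\<close>. On each
  half one of the ramps equals 1, where \<open>osc\<close> vanishes, so
  \<open>\<sigma> * osc\<close> of the distance to the nearer face enters with opposite signs on the
  two halves. Clamping by \<open>ramp\<close> makes the function Lipschitz on the whole
  line.\<close>

definition potential :: "real \<Rightarrow> real \<Rightarrow> real" where
  "potential \<sigma> y = ramp y + ramp (- y) - 1 + \<sigma> * (osc (ramp y) - osc (ramp (- y)))"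

lemma osc_0: "osc 0 = 0" and osc_1: "osc 1 = 0"
  by (simp_all add: osc_def)

text \<open>For \<open>a > 0\<close> the derivative is bounded by \<open>8 / 16\<close>, using
  \<open>pi < 4\<close>. For \<open>a = 0\<close>, where the formula for the derivative breaks down,
  the quadratic factor gives the bound directly.\<close>

lemma osc_lipschitz_aux:
  assumes "0 \<le> a" "a < b" "b \<le> 1"
  shows "\<bar>osc b - osc a\<bar> \<le> (b - a) / 2"
proof (cases "a = 0")
  case True
  have "\<bar>osc b\<bar> = b\<^sup>2 * \<bar>sin (pi / b)\<bar> / 16" by (simp add: osc_def abs_mult)
  also have "\<dots> \<le> b\<^sup>2 * 1 / 16" by (intro divide_right_mono mult_left_mono) auto
  also have "\<dots> \<le> b / 2" using assms by (simp add: power2_eq_square mult_le_one)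
  finally show ?thesis using True by (simp add: osc_0)
next
  case False
  let ?D = "\<lambda>s. (2 * s * sin (pi / s) - pi * cos (pi / s)) / 16"
  have "(osc has_real_derivative ?D s) (at s)" if "a \<le> s" "s \<le> b" for s
    unfolding osc_def using that False assms
    by (auto intro!: derivative_eq_intros simp: field_simps power2_eq_square)
  then obtain s where s: "a < s" "s < b" "osc b - osc a = (b - a) * ?D s"
    using MVT2[of a b osc ?D] assms by auto
  have "\<bar>2 * s * sin (pi / s)\<bar> \<le> 2 * s * 1"
    unfolding abs_mult using s assms by (intro mult_mono) auto
  moreover have "\<bar>pi * cos (pi / s)\<bar> \<le> pi * 1"
    unfolding abs_mult by (intro mult_mono) auto
  ultimately have "\<bar>2 * s * sin (pi / s) - pi * cos (pi / s)\<bar> \<le> 8"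
    using s(1,2) assms pi_less_4 by linarith
  then have "\<bar>?D s\<bar> \<le> 1 / 2" by simp
  then have "(b - a) * \<bar>?D s\<bar> \<le> (b - a) * (1 / 2)" using assms by (intro mult_left_mono) auto
  then show ?thesis unfolding s abs_mult using assms by simp
qed

lemma osc_lipschitz:
  assumes "a \<in> {0..1}" "b \<in> {0..1}"
  shows "\<bar>osc a - osc b\<bar> \<le> \<bar>a - b\<bar> / 2"
  using osc_lipschitz_aux[of a b] osc_lipschitz_aux[of b a] assms
  by (cases a b rule: linorder_cases) (auto simp: abs_minus_commute)

lemma ramp_range: "ramp y \<in> {0..1}"
  by (simp add: ramp_def)

lemma ramp_lipschitz: "\<bar>ramp x - ramp y\<bar> \<le> \<bar>x - y\<bar>"
  by (auto simp: ramp_def min_def max_def)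

lemma osc_ramp_lipschitz: "\<bar>osc (ramp x) - osc (ramp y)\<bar> \<le> \<bar>x - y\<bar> / 2"
  using osc_lipschitz[OF ramp_range ramp_range, of x y] ramp_lipschitz[of x y] by simp

lemma potential_lipschitz:
  assumes "\<bar>\<sigma>\<bar> = 1"
  shows "\<bar>potential \<sigma> x - potential \<sigma> y\<bar> \<le> 3 * \<bar>x - y\<bar>"
proof -
  define a b where "a = ramp x - ramp y" and "b = ramp (- x) - ramp (- y)"
  define A B where "A = osc (ramp x) - osc (ramp y)" and "B = osc (ramp (- x)) - osc (ramp (- y))"
  have ab: "\<bar>a\<bar> \<le> \<bar>x - y\<bar>" "\<bar>b\<bar> \<le> \<bar>x - y\<bar>"
    using ramp_lipschitz[of x y] ramp_lipschitz[of "- x" "- y"]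
    by (simp_all add: a_def b_def abs_minus_commute)
  have "\<bar>A\<bar> \<le> \<bar>x - y\<bar> / 2" "\<bar>B\<bar> \<le> \<bar>x - y\<bar> / 2"
    using osc_ramp_lipschitz[of x y] osc_ramp_lipschitz[of "- x" "- y"]
    by (simp_all add: A_def B_def abs_minus_commute)
  then have C: "\<bar>\<sigma> * (A - B)\<bar> \<le> \<bar>x - y\<bar>"
    using assms abs_triangle_ineq4[of A B] by (simp add: abs_mult)
  have "potential \<sigma> x - potential \<sigma> y = a + b + \<sigma> * (A - B)"
    by (simp add: potential_def a_def b_def A_def B_def algebra_simps)
  also have "\<bar>\<dots>\<bar> \<le> \<bar>a\<bar> + \<bar>b\<bar> + \<bar>\<sigma> * (A - B)\<bar>"
    by (intro order_trans[OF abs_triangle_ineq] add_right_mono abs_triangle_ineq)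
  also have "\<dots> \<le> \<bar>x - y\<bar> + \<bar>x - y\<bar> + \<bar>x - y\<bar>" by (intro add_mono ab C)
  finally show ?thesis by simp
qed

lemma continuous_potential:
  assumes "\<bar>\<sigma>\<bar> = 1" shows "continuous_on UNIV (potential \<sigma>)"
proof -
  have "3-lipschitz_on UNIV (potential \<sigma>)"
    using potential_lipschitz[OF assms] by (intro lipschitz_onI) (auto simp: dist_real_def)
  then show ?thesis by (rule lipschitz_on_continuous_on)
qed

lemma potential_uminus: "potential \<sigma> (- y) = potential (- \<sigma>) y"
  by (simp add: potential_def algebra_simps)

lemma potential_nonneg_arg: "0 \<le> y \<Longrightarrow> y \<le> 1 \<Longrightarrow> potential \<sigma> y = (1 - y) + \<sigma> * osc (1 - y)"
  by (simp add: potential_def ramp_def osc_1)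

lemma potential_nonpos_arg: "y \<le> 0 \<Longrightarrow> -1 \<le> y \<Longrightarrow> potential \<sigma> y = (1 + y) - \<sigma> * osc (1 + y)"
  by (simp add: potential_def ramp_def osc_1)

lemma potential_le_2:
  assumes "\<bar>\<sigma>\<bar> = 1" shows "potential \<sigma> y \<le> 2"
proof -
  have "\<bar>osc (ramp y) - osc (ramp (- y))\<bar> \<le> 1 / 2"
    using osc_lipschitz[OF ramp_range ramp_range, of y "- y"] ramp_range[of y] ramp_range[of "- y"]
    by auto
  then have "\<bar>\<sigma> * (osc (ramp y) - osc (ramp (- y)))\<bar> \<le> 1 / 2" using assms by (simp add: abs_mult)
  moreover have "ramp y \<le> 1" "ramp (- y) \<le> 1" using ramp_range by auto
  ultimately show ?thesis unfolding potential_def by linarith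
qed

text \<open>On the better half the linear part has slope 1 and the oscillation at most 1/2, so the
  potential grows at least at rate 1/2 away from the face. On the other half at least
  \<open>- 2 * \<sigma> * osc s\<close> remains, and the distance to the better face is at most 2.
  The resulting linear lower bound is what a small multiple of \<open>z\<close> can be compared
  with.\<close>

lemma potential_diff_bounds:
  assumes \<sigma>: "\<bar>\<sigma>\<bar> = 1" and s: "0 < s" "s \<le> 1 / 12" and neg: "\<sigma> * osc s < 0"
  shows "y \<in> {-(1-s)..1-s} \<Longrightarrow>
      min (1/2) (- \<sigma> * osc s) * ((1 - s) - y) \<le> potential \<sigma> y - potential \<sigma> (1 - s)"
    and "y \<in> {-(1-s)..1-s} \<Longrightarrow> potential \<sigma> y - potential \<sigma> (1 - s) \<le> 2"
    and "\<bar>y\<bar> \<le> 1/2 \<Longrightarrow> 1/8 \<le> potential \<sigma> y - potential \<sigma> (1 - s)"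
proof -
  let ?t = "1 - s" and ?\<kappa> = "min (1/2) (- \<sigma> * osc s)"
  have lip: "\<bar>\<sigma> * osc a - \<sigma> * osc b\<bar> \<le> \<bar>a - b\<bar> / 2" if "a \<in> {0..1}" "b \<in> {0..1}" for a b
    using osc_lipschitz[OF that] \<sigma> by (simp add: abs_mult flip: right_diff_distrib)
  have Vt: "potential \<sigma> ?t = s + \<sigma> * osc s" using s by (simp add: potential_nonneg_arg)
  have osc_s: "\<bar>\<sigma> * osc s\<bar> \<le> s / 2" using lip[of s 0] s by (simp add: osc_0)
  show "?\<kappa> * (?t - y) \<le> potential \<sigma> y - potential \<sigma> ?t" if y: "y \<in> {-?t..?t}"
  proof (cases "y \<ge> 0")
    case True
    have "?\<kappa> * (?t - y) \<le> (1/2) * (?t - y)" using y by (intro mult_right_mono) auto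
    moreover have "\<bar>\<sigma> * osc (1 - y) - \<sigma> * osc s\<bar> \<le> \<bar>1 - y - s\<bar> / 2"
      using lip[of "1 - y" s] True y s by auto
    moreover have "potential \<sigma> y = (1 - y) + \<sigma> * osc (1 - y)"
      using True y s by (intro potential_nonneg_arg) auto
    moreover have "0 \<le> 1 - y - s" using y by simp
    ultimately show ?thesis unfolding Vt by argo
  next
    case False
    have "?\<kappa> * (?t - y) \<le> (- \<sigma> * osc s) * (?t - y)" using y by (intro mult_right_mono) auto
    also have "\<dots> \<le> (- \<sigma> * osc s) * 2" using y s neg by (intro mult_left_mono) auto
    finally have 1: "?\<kappa> * (?t - y) \<le> - 2 * (\<sigma> * osc s)" by simp
    have "\<bar>\<sigma> * osc (1 + y) - \<sigma> * osc s\<bar> \<le> \<bar>1 + y - s\<bar> / 2"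
      using lip[of "1 + y" s] False y s by auto
    moreover have "potential \<sigma> y = (1 + y) - \<sigma> * osc (1 + y)"
      using False y s by (intro potential_nonpos_arg) auto
    moreover have "0 \<le> 1 + y - s" using y by simp
    ultimately show ?thesis using 1 unfolding Vt by argo
  qed
  show "potential \<sigma> y - potential \<sigma> ?t \<le> 2" if y: "y \<in> {-?t..?t}"
    using potential_le_2[OF \<sigma>, of y] osc_s s unfolding Vt by linarith
  \<comment> \<open>For these \<open>y\<close> the potential is at least 1/4, while its value at
    \<open>?t\<close> is at most \<open>3 * s / 2\<close>, hence at most 1/8.\<close>
  show "1/8 \<le> potential \<sigma> y - potential \<sigma> ?t" if y: "\<bar>y\<bar> \<le> 1/2"
  proof (cases "y \<ge> 0")
    case True
    then have "\<bar>\<sigma> * osc (1 - y)\<bar> \<le> (1 - y) / 2" "potential \<sigma> y = (1 - y) + \<sigma> * osc (1 - y)"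
      using lip[of "1 - y" 0] y by (auto simp: osc_0 potential_nonneg_arg)
    then show ?thesis using y s osc_s unfolding Vt by argo
  next
    case False
    then have "\<bar>\<sigma> * osc (1 + y)\<bar> \<le> (1 + y) / 2" "potential \<sigma> y = (1 + y) - \<sigma> * osc (1 + y)"
      using lip[of "1 + y" 0] y by (auto simp: osc_0 potential_nonpos_arg)
    then show ?thesis using y s osc_s unfolding Vt by argo
  qed
qed

section \<open>The slope of the normalised solutions near the centre\<close>

definition normalized_solution :: "real \<Rightarrow> ('a::euclidean_space \<Rightarrow> 'a \<Rightarrow> real) \<Rightarrow> 'a set \<Rightarrow> 'a \<Rightarrow> real"
  where "normalized_solution \<delta> H D x =
    the_state_constraint_solution \<delta> H D x + additive_eigenvalue H D / \<delta>"

text \<open>On \<open>{-1/2..1/2}\<close> the slope of \<open>z\<close> is at most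
  \<open>1/16 - 1/8\<close>, so \<open>z\<close> drops by 1/16 towards the better face. The
  threshold \<open>\<delta>0\<close> depends on \<open>s\<close>, but the size of the drop does
  not.\<close>

lemma normalized_solution_gap_directed:
  fixes e :: "'a::euclidean_space"
  assumes e: "e \<in> Basis \<or> - e \<in> Basis" and \<sigma>: "\<bar>\<sigma>\<bar> = 1"
    and s: "0 < s" "s \<le> 1 / 12" and neg: "\<sigma> * osc s < 0"
  obtains \<delta>0 where "\<delta>0 > 0" "\<And>\<delta>. 0 < \<delta> \<Longrightarrow> \<delta> \<le> \<delta>0 \<Longrightarrow>
    1/16 \<le> normalized_solution \<delta> (\<lambda>x p. norm p - potential \<sigma> (x \<bullet> e)) (cube (1 - s)) (- (1/2) *\<^sub>R e)
         - normalized_solution \<delta> (\<lambda>x p. norm p - potential \<sigma> (x \<bullet> e)) (cube (1 - s)) ((1/2) *\<^sub>R e)"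
proof
  let ?V = "potential \<sigma>" and ?t = "1 - s"
  define \<kappa> where "\<kappa> = min (1/2) (- \<sigma> * osc s)"
  \<comment> \<open>With \<open>z y \<le> 2 * (?t - y)\<close>, the first entry yields
    \<open>\<delta> * z y \<le> ?V y - ?V ?t\<close>, and the second, as \<open>z \<le> 4\<close>,
    yields \<open>\<delta> * z y \<le> 1/16\<close>.\<close>
  define \<delta>0 where "\<delta>0 = min (\<kappa> / 2) (1 / 64)"
  have \<kappa>: "\<kappa> > 0" using neg by (simp add: \<kappa>_def)
  then show "\<delta>0 > 0" by (simp add: \<delta>0_def)
  note bounds = potential_diff_bounds[OF \<sigma> s neg, folded \<kappa>_def]
  have ht: "0 < ?t" "?t \<le> 1" "1/2 < ?t" using s by auto
  have V_min: "?V ?t \<le> ?V y" if "y \<in> {-?t..?t}" for y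
  proof -
    have "0 \<le> \<kappa> * (?t - y)" using \<kappa> that by simp
    then show ?thesis using bounds(1)[OF that] by linarith
  qed
  fix \<delta> :: real assume h\<delta>: "0 < \<delta>" "\<delta> \<le> \<delta>0"
  obtain z where z:
    "\<And>y. y \<in> {-2<..<2} \<Longrightarrow> (z has_real_derivative \<delta> * z y - (?V y - ?V ?t)) (at y)"
    "z ?t = 0" "\<And>y. y \<in> {-?t..?t} \<Longrightarrow> 0 \<le> z y" "\<And>y. y \<in> {-?t..?t} \<Longrightarrow> z y \<le> 2 * (?t - y)"
    using discounted_profile_exists[OF continuous_potential[OF \<sigma>] ht(1,2) h\<delta>(1) V_min bounds(2)]
    by metis
  have z_le: "\<delta> * z y \<le> ?V y - ?V ?t" if y: "y \<in> {-?t..?t}" for y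
  proof -
    have "\<delta> * z y \<le> (\<kappa> / 2) * (2 * (?t - y))"
      using h\<delta> z(3,4)[OF y] \<kappa> by (intro mult_mono) (auto simp: \<delta>0_def)
    also have "\<dots> = \<kappa> * (?t - y)" by simp
    also have "\<dots> \<le> ?V y - ?V ?t" by (rule bounds(1)[OF y])
    finally show ?thesis .
  qed
  interpret eikonal_cube e ?V z ?t \<delta>
    by unfold_locales (fact e ht(1,2) h\<delta>(1) continuous_potential[OF \<sigma>] z(1,2) z_le V_min)+
  have zsol: "normalized_solution \<delta> (\<lambda>x p. norm p - ?V (x \<bullet> e)) (cube ?t) (c *\<^sub>R e) = z c"
    if "\<bar>c\<bar> \<le> 1/2" for c
  proof -
    have "c *\<^sub>R e \<in> closure (cube ?t)"
      unfolding closure_cube[OF ht(1)]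
    proof (intro CollectI ballI)
      fix i :: 'a assume "i \<in> Basis"
      then have "\<bar>(c *\<^sub>R e) \<bullet> i\<bar> \<le> norm (c *\<^sub>R e)" by (rule Basis_le_norm)
      then show "\<bar>(c *\<^sub>R e) \<bullet> i\<bar> \<le> ?t" using norm_e that ht(3) by (simp del: inner_scaleR_left)
    qed
    from normalized_solution_eq[OF this] show ?thesis
      by (simp add: normalized_solution_def inner_e_e)
  qed
  obtain \<xi> where \<xi>: "-(1/2) < \<xi>" "\<xi> < 1/2"
    "z (1/2) - z (-(1/2)) = (1/2 - -(1/2)) * (\<delta> * z \<xi> - (?V \<xi> - ?V ?t))"
    using MVT2[of "-(1/2)" "1/2" z "\<lambda>y. \<delta> * z y - (?V y - ?V ?t)"] z(1) by auto
  have \<xi>t: "\<xi> \<in> {-?t..?t}" using \<xi> ht by auto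
  have "\<delta> * z \<xi> \<le> (1/64) * 4"
    using h\<delta> z(3,4)[OF \<xi>t] \<xi> ht by (intro mult_mono) (auto simp: \<delta>0_def)
  moreover have "1/8 \<le> ?V \<xi> - ?V ?t" using bounds(3)[of \<xi>] \<xi> by auto
  ultimately have "1/16 \<le> z (-(1/2)) - z (1/2)" using \<xi>(3) by simp
  then show "1/16 \<le> normalized_solution \<delta> (\<lambda>x p. norm p - ?V (x \<bullet> e)) (cube ?t) (- (1/2) *\<^sub>R e)
         - normalized_solution \<delta> (\<lambda>x p. norm p - ?V (x \<bullet> e)) (cube ?t) ((1/2) *\<^sub>R e)"
    using zsol[of "-(1/2)"] zsol[of "1/2"] by simp
qed

text \<open>If \<open>osc s < 0\<close> the face in direction \<open>e\<close> is better. Otherwise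
  reflection applies: replacing \<open>e\<close> by \<open>- e\<close> and 1 by \<open>-1\<close>
  gives the same Hamiltonian.\<close>

lemma normalized_solution_gap:
  fixes e :: "'a::euclidean_space"
  assumes e: "e \<in> Basis" and s: "0 < s" "s \<le> 1 / 12" and osc: "osc s \<noteq> 0"
  shows "\<exists>\<delta>0>0. \<forall>\<delta>. 0 < \<delta> \<longrightarrow> \<delta> \<le> \<delta>0 \<longrightarrow> 1/16 \<le> sgn (osc s) *
    (normalized_solution \<delta> (\<lambda>x p. norm p - potential 1 (x \<bullet> e)) (cube (1 - s)) ((1/2) *\<^sub>R e)
   - normalized_solution \<delta> (\<lambda>x p. norm p - potential 1 (x \<bullet> e)) (cube (1 - s)) (- (1/2) *\<^sub>R e))"
proof (cases "osc s < 0")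
  case True
  obtain \<delta>0 where "\<delta>0 > 0" "\<And>\<delta>. 0 < \<delta> \<Longrightarrow> \<delta> \<le> \<delta>0 \<Longrightarrow>
    1/16 \<le> normalized_solution \<delta> (\<lambda>x p. norm p - potential 1 (x \<bullet> e)) (cube (1 - s)) (- (1/2) *\<^sub>R e)
         - normalized_solution \<delta> (\<lambda>x p. norm p - potential 1 (x \<bullet> e)) (cube (1 - s)) ((1/2) *\<^sub>R e)"
    using normalized_solution_gap_directed[of e 1 s] e s True by auto
  then show ?thesis using True by (intro exI[of _ \<delta>0]) auto
next
  case False
  then have pos: "osc s > 0" using osc by simp
  obtain \<delta>0 where "\<delta>0 > 0" "\<And>\<delta>. 0 < \<delta> \<Longrightarrow> \<delta> \<le> \<delta>0 \<Longrightarrow>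
    1/16 \<le> normalized_solution \<delta> (\<lambda>x p. norm p - potential (-1) (x \<bullet> - e)) (cube (1 - s)) (- (1/2) *\<^sub>R - e)
         - normalized_solution \<delta> (\<lambda>x p. norm p - potential (-1) (x \<bullet> - e)) (cube (1 - s)) ((1/2) *\<^sub>R - e)"
    using normalized_solution_gap_directed[of "- e" "-1" s] e s pos by auto
  then show ?thesis using pos by (intro exI[of _ \<delta>0]) (auto simp: potential_uminus)
qed

text \<open>Chosen so that \<open>pi / offset k\<close> is \<open>k * pi + pi / 2\<close> up to six
  full periods, where the sine is alternately 1 and \<open>-1\<close>; the shift by 25 ensures
  \<open>offset k \<le> 1 / 12\<close>.\<close>

definition offset :: "nat \<Rightarrow> real" where "offset k = 2 / (2 * real k + 25)"

lemma offset_bounds: "0 < offset k" "offset k \<le> 1 / 12"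
  by (simp_all add: offset_def field_simps)

lemma sgn_osc_offset: "sgn (osc (offset k)) = (-1) ^ k"
proof -
  have "pi / offset k = real k * pi + pi / 2 + 12 * pi"
    by (simp add: offset_def field_simps)
  then have "sin (pi / offset k) = sin (real k * pi + pi / 2 + real 6 * (2 * pi))" by simp
  also have "\<dots> = (-1) ^ k"
    unfolding sin_add cos_add by (simp add: cos_npi sin_npi sin_npi2 cos_npi2)
  finally have "osc (offset k) = (offset k)\<^sup>2 / 16 * (-1) ^ k" unfolding osc_def by simp
  moreover have "(offset k)\<^sup>2 / 16 > 0" using offset_bounds(1)[of k] by simp
  ultimately show ?thesis by (simp only: sgn_mult sgn_pos) (cases "even k"; simp)
qed

lemma offset_tendsto: "offset \<longlonglongrightarrow> 0"
proof (rule real_tendsto_sandwich[OF _ _ tendsto_const])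
  show "(\<lambda>k. 1 / (real (Suc k))) \<longlonglongrightarrow> 0"
    using LIMSEQ_inverse_real_of_nat by (simp add: inverse_eq_divide)
qed (auto simp: offset_def field_simps)

section \<open>Choice of the discount\<close>

text \<open>The infimum over \<open>j\<close> of \<open>d j + max 0 (l - lam j)\<close> inherits
  monotonicity and the Lipschitz constant 1. It is positive at \<open>l > 0\<close> because all but
  finitely many \<open>lam j\<close> lie below \<open>l / 2\<close>, and it tends to 0 because it is
  at most \<open>d j\<close> up to \<open>lam j\<close>.\<close>

lemma small_modulus_exists:
  fixes lam d :: "nat \<Rightarrow> real"
  assumes lam: "\<And>j. lam j > 0" "lam \<longlonglongrightarrow> 0" and d: "\<And>j. d j > 0" "d \<longlonglongrightarrow> 0"
  obtains \<phi> :: "real \<Rightarrow> real" where "continuous_on UNIV \<phi>" "mono \<phi>" "\<And>l. l > 0 \<Longrightarrow> \<phi> l > 0"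
    "(\<phi> \<longlongrightarrow> 0) (at_right 0)" "\<And>j. \<phi> (lam j) \<le> d j"
proof
  define f where "f j l = d j + max 0 (l - lam j)" for j l
  define \<phi> where "\<phi> l = (INF j. f j l)" for l
  have f0: "0 \<le> f j l" for j l using d(1)[of j] by (simp add: f_def)
  then have bdd: "bdd_below (range (\<lambda>j. f j l))" for l by (intro bdd_belowI[of _ 0]) auto
  have le: "\<phi> l \<le> f j l" for j l unfolding \<phi>_def by (rule cINF_lower[OF bdd]) simp
  have ge: "c \<le> \<phi> l" if "\<And>j. c \<le> f j l" for c l
    unfolding \<phi>_def using that by (intro cINF_greatest) auto
  show mono: "mono \<phi>"
  proof (rule monoI)
    fix x y :: real assume xy: "x \<le> y"
    show "\<phi> x \<le> \<phi> y"
    proof (rule ge)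
      fix j
      have "f j x \<le> f j y" using xy by (simp add: f_def)
      then show "\<phi> x \<le> f j y" using le[of x j] by linarith
    qed
  qed
  have lip: "\<phi> y - \<phi> x \<le> y - x" if "x \<le> y" for x y
  proof -
    have "\<phi> y - (y - x) \<le> f j x" for j
      using le[of y j] that by (simp add: f_def)
    from ge[OF this] show ?thesis by simp
  qed
  have "\<bar>\<phi> x - \<phi> y\<bar> \<le> \<bar>x - y\<bar>" for x y
    using lip[of x y] lip[of y x] monoD[OF mono, of x y] monoD[OF mono, of y x]
    by (cases "x \<le> y") auto
  then have "1-lipschitz_on UNIV \<phi>" by (intro lipschitz_onI) (auto simp: dist_real_def)
  then show "continuous_on UNIV \<phi>" by (rule lipschitz_on_continuous_on)
  show "\<phi> (lam j) \<le> d j" for j using le[of "lam j" j] by (simp add: f_def)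
  show pos: "\<phi> l > 0" if l: "l > 0" for l
  proof -
    obtain N where N: "\<And>j. j \<ge> N \<Longrightarrow> lam j < l / 2"
      using order_tendstoD(2)[OF lam(2), of "l / 2"] l by (auto simp: eventually_sequentially)
    define c where "c = Min (insert (l / 2) (d ` {..<N}))"
    have "c > 0" using l d by (simp add: c_def)
    moreover have "c \<le> f j l" for j
    proof (cases "j < N")
      case True
      then have "c \<le> d j" unfolding c_def by (intro Min_le) auto
      then show ?thesis by (simp add: f_def)
    next
      case False
      have "c \<le> l / 2" unfolding c_def by (intro Min_le) auto
      then show ?thesis using N[of j] False d(1)[of j] by (simp add: f_def)
    qed
    ultimately show ?thesis using ge[of c l] by simp
  qed
  show "(\<phi> \<longlongrightarrow> 0) (at_right 0)"
  proof (rule tendstoI)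
    fix \<epsilon> :: real assume \<epsilon>: "\<epsilon> > 0"
    obtain j where j: "d j < \<epsilon>"
      using order_tendstoD(2)[OF d(2) \<epsilon>] by (auto simp: eventually_sequentially)
    have "dist (\<phi> l) 0 < \<epsilon>" if l: "0 < l" "l < lam j" for l
      using pos[OF l(1)] le[of l j] l(2) j by (simp add: f_def)
    then show "\<forall>\<^sub>F l in at_right 0. dist (\<phi> l) 0 < \<epsilon>"
      unfolding eventually_at_right_field using lam(1)[of j] by blast
  qed
qed

lemma exists_value_at_right_0:
  fixes r :: "real \<Rightarrow> real"
  assumes r: "continuous_on {0<..} r" "\<And>l. l > 0 \<Longrightarrow> r l \<le> 0" "(r \<longlongrightarrow> 0) (at_right 0)"
    and nz: "\<And>\<epsilon>. \<epsilon> > 0 \<Longrightarrow> \<exists>l\<in>{0<..<\<epsilon>}. r l \<noteq> 0" and \<epsilon>: "\<epsilon> > 0"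
    and a: "\<And>k. a k > 0" "a \<longlonglongrightarrow> 0"
  shows "\<exists>N. \<forall>k\<ge>N. \<exists>l\<in>{0<..<\<epsilon>}. r l = - a k"
proof -
  obtain l where l: "0 < l" "l < \<epsilon>" "r l < 0"
    using nz[OF \<epsilon>] r(2) by (force simp: order_less_le)
  obtain N where N: "\<And>k. k \<ge> N \<Longrightarrow> a k < - r l"
    using order_tendstoD(2)[OF a(2), of "- r l"] l by (auto simp: eventually_sequentially)
  have "\<exists>l'\<in>{0<..<\<epsilon>}. r l' = - a k" if "k \<ge> N" for k
  proof -
    have "\<forall>\<^sub>F x in at_right 0. - a k < r x"
      using order_tendstoD(1)[OF r(3), of "- a k"] a(1)[of k] by simp
    then obtain b where b: "b > 0" "\<And>x. 0 < x \<Longrightarrow> x < b \<Longrightarrow> - a k < r x"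
      unfolding eventually_at_right_field by blast
    define c where "c = min (b / 2) l"
    have c: "0 < c" "c < b" "c \<le> l" using b(1) l by (auto simp: c_def)
    have "continuous_on {c..l} r"
      using c by (intro continuous_on_subset[OF r(1)]) auto
    then obtain x where "c \<le> x" "x \<le> l" "r x = - a k"
      using IVT2'[of r l "- a k" c] b(2)[of c] c N[of k] \<open>k \<ge> N\<close> by auto
    then show ?thesis using c l by (intro bexI[of _ x]) auto
  qed
  then show ?thesis by blast
qed

lemma divergent_discount_exists:
  fixes e :: "'a::euclidean_space" and r :: "real \<Rightarrow> real"
  assumes e: "e \<in> Basis"
    and r: "continuous_on {0<..} r" "\<And>l. l > 0 \<Longrightarrow> r l \<le> 0" "(r \<longlongrightarrow> 0) (at_right 0)"
    and nz: "\<And>\<epsilon>. \<epsilon> > 0 \<Longrightarrow> \<exists>l\<in>{0<..<\<epsilon>}. r l \<noteq> 0"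
  shows "\<exists>\<phi> lam. continuous_on {0<..} \<phi> \<and> mono_on {0<..} \<phi> \<and> (\<forall>l>0. \<phi> l > 0) \<and>
        (\<phi> \<longlongrightarrow> 0) (at_right 0) \<and>
        (\<forall>j::nat. lam j > 0 \<and> 1 + r (lam j) > 0) \<and> lam \<longlonglongrightarrow> 0 \<and>
        filterlim (\<lambda>j. r (lam j) / \<phi> (lam j)) at_bot sequentially \<and>
        \<not> converges_locally_uniformly (cube 1)
            (\<lambda>j. normalized_solution (\<phi> (lam j)) (\<lambda>x p. norm p - potential 1 (x \<bullet> e))
              (dilate (1 + r (lam j)) (cube 1)))"
proof -
  let ?u = "\<lambda>\<delta> s. normalized_solution \<delta> (\<lambda>x p. norm p - potential 1 (x \<bullet> e)) (cube (1 - s))"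
  let ?x = "(1/2) *\<^sub>R e" and ?y = "- (1/2) *\<^sub>R e"
  have "\<exists>l k. l \<in> {0<..<1 / real (Suc j)} \<and> (even k \<longleftrightarrow> even j) \<and> r l = - offset k" for j
  proof -
    obtain N where N: "\<forall>k\<ge>N. \<exists>l\<in>{0<..<1 / real (Suc j)}. r l = - offset k"
      using exists_value_at_right_0[OF r nz, of "1 / real (Suc j)" offset] offset_bounds offset_tendsto
      by auto
    \<comment> \<open>The index \<open>2 * N + j\<close> is large enough and has the parity of
      \<open>j\<close>, so the better face alternates with \<open>j\<close>.\<close>
    have "2 * N + j \<ge> N" "even (2 * N + j) \<longleftrightarrow> even j" by auto
    then show ?thesis using N by blast
  qed
  then obtain lam k where lk: "\<And>j. lam j \<in> {0<..<1 / real (Suc j)}"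
    "\<And>j. even (k j) \<longleftrightarrow> even j" "\<And>j. r (lam j) = - offset (k j)"
    by metis
  have "\<exists>\<delta>0>0. \<forall>\<delta>. 0 < \<delta> \<longrightarrow> \<delta> \<le> \<delta>0 \<longrightarrow>
      1/16 \<le> (-1) ^ j * (?u \<delta> (offset (k j)) ?x - ?u \<delta> (offset (k j)) ?y)" for j
  proof -
    have sg: "sgn (osc (offset (k j))) = (-1) ^ j"
      using lk(2)[of j] by (cases "even j") (auto simp: sgn_osc_offset)
    then have "osc (offset (k j)) \<noteq> 0" by auto
    from normalized_solution_gap[OF e offset_bounds this] show ?thesis unfolding sg .
  qed
  then obtain \<delta>0 where \<delta>0: "\<And>j. \<delta>0 j > 0" "\<And>j \<delta>. 0 < \<delta> \<Longrightarrow> \<delta> \<le> \<delta>0 j \<Longrightarrow>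
      1/16 \<le> (-1) ^ j * (?u \<delta> (offset (k j)) ?x - ?u \<delta> (offset (k j)) ?y)"
    by metis
  \<comment> \<open>The first entry guarantees the gap at \<open>lam j\<close>; the second makes
    \<open>r / \<phi>\<close> at most \<open>- real (Suc j)\<close> there.\<close>
  define d where "d j = min (\<delta>0 j) (offset (k j) / real (Suc j))" for j
  have d: "d j > 0" "d j \<le> \<delta>0 j" "d j \<le> offset (k j) / real (Suc j)" for j
    using \<delta>0(1)[of j] offset_bounds(1)[of "k j"] by (auto simp: d_def)
  have inv0: "(\<lambda>j. 1 / real (Suc j)) \<longlonglongrightarrow> 0"
    using LIMSEQ_inverse_real_of_nat by (simp add: inverse_eq_divide)
  have lam0: "lam \<longlonglongrightarrow> 0"
    by (rule real_tendsto_sandwich[OF _ _ tendsto_const inv0])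
      (use lk(1) in \<open>auto intro!: always_eventually less_imp_le\<close>)
  have "d j \<le> 1 / real (Suc j)" for j
  proof -
    have "offset (k j) / real (Suc j) \<le> 1 / real (Suc j)"
      using offset_bounds[of "k j"] by (intro divide_right_mono) auto
    then show ?thesis using d(3)[of j] by linarith
  qed
  then have "d \<longlonglongrightarrow> 0"
    by (intro real_tendsto_sandwich[OF _ _ tendsto_const inv0])
      (use d(1) in \<open>auto intro!: always_eventually less_imp_le\<close>)
  then obtain \<phi> where \<phi>: "continuous_on UNIV \<phi>" "mono \<phi>" "\<And>l. l > 0 \<Longrightarrow> \<phi> l > 0"
    "(\<phi> \<longlongrightarrow> 0) (at_right 0)" "\<And>j. \<phi> (lam j) \<le> d j"
    using small_modulus_exists[of lam d] lk(1) lam0 d(1) by auto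
  have lam: "lam j > 0" "1 + r (lam j) > 0" for j
    using lk(1)[of j] lk(3)[of j] offset_bounds(2)[of "k j"] by auto
  have "filterlim (\<lambda>j. r (lam j) / \<phi> (lam j)) at_bot sequentially"
  proof (rule filterlim_at_bot_mono)
    show "filterlim (\<lambda>j. - real j) at_bot sequentially"
      using filterlim_real_sequentially by (simp add: filterlim_uminus_at_top)
    have "r (lam j) / \<phi> (lam j) \<le> - real j" for j
    proof -
      have "\<phi> (lam j) \<le> offset (k j) / real (Suc j)" using \<phi>(5)[of j] d(3)[of j] by simp
      then have "\<phi> (lam j) * real (Suc j) \<le> offset (k j)" by (simp add: field_simps)
      then have "real (Suc j) \<le> offset (k j) / \<phi> (lam j)"
        using \<phi>(3)[OF lam(1)[of j]] by (simp add: field_simps)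
      then show ?thesis by (simp add: lk(3))
    qed
    then show "\<forall>\<^sub>F j in sequentially. r (lam j) / \<phi> (lam j) \<le> - real j" by simp
  qed
  moreover have "\<not> converges_locally_uniformly (cube 1)
            (\<lambda>j. normalized_solution (\<phi> (lam j)) (\<lambda>x p. norm p - potential 1 (x \<bullet> e))
              (dilate (1 + r (lam j)) (cube 1)))"
  proof
    define U where "U j = ?u (\<phi> (lam j)) (offset (k j))" for j
    assume "converges_locally_uniformly (cube 1)
            (\<lambda>j. normalized_solution (\<phi> (lam j)) (\<lambda>x p. norm p - potential 1 (x \<bullet> e))
              (dilate (1 + r (lam j)) (cube 1)))"
    then have "converges_locally_uniformly (cube 1) U"
      unfolding dilate_cube[OF lam(2)] by (simp add: lk(3) U_def[abs_def])
    moreover have "compact {?x, ?y}" "{?x, ?y} \<subseteq> cube 1"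
      using e by (auto simp: cube_def inner_Basis)
    ultimately obtain g where g: "uniform_limit {?x, ?y} U g sequentially"
      unfolding converges_locally_uniformly_def by blast
    have "(\<lambda>j. U j ?x) \<longlonglongrightarrow> g ?x" "(\<lambda>j. U j ?y) \<longlonglongrightarrow> g ?y"
      using tendsto_uniform_limitI[OF g] by auto
    then have "(\<lambda>j. U j ?x - U j ?y) \<longlonglongrightarrow> g ?x - g ?y" by (rule tendsto_diff)
    then have "Cauchy (\<lambda>j. U j ?x - U j ?y)" by (rule LIMSEQ_imp_Cauchy)
    then obtain M where M: "\<And>m n. m \<ge> M \<Longrightarrow> n \<ge> M \<Longrightarrow>
        dist (U m ?x - U m ?y) (U n ?x - U n ?y) < 1/16"
      using metric_CauchyD[of "\<lambda>j. U j ?x - U j ?y" "1/16"] by auto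
    have gap: "1/16 \<le> (-1) ^ j * (U j ?x - U j ?y)" for j
      unfolding U_def using \<phi>(5)[of j] d(2)[of j] \<phi>(3)[OF lam(1)[of j]] by (intro \<delta>0(2)) auto
    show False
      \<comment> \<open>At consecutive indices the differences are at least 1/16 and at most
        \<open>-1/16\<close>, too far apart for a Cauchy sequence.\<close>
      using M[of "2 * M" "2 * M + 1"] gap[of "2 * M"] gap[of "2 * M + 1"]
      unfolding dist_real_def by simp
  qed
  moreover have "continuous_on {0<..} \<phi>" "mono_on {0<..} \<phi>"
    using continuous_on_subset[OF \<phi>(1)] \<phi>(2) by (auto simp: mono_on_def mono_def)
  ultimately show ?thesis
    using \<phi>(3,4) lam lam0 by (intro exI[of _ \<phi>] exI[of _ lam] conjI allI impI)
qed

section \<open>Structural properties of the Hamiltonian and the final assembly\<close>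

lemma eikonal_coercive:
  assumes V: "\<And>y. V y \<le> (M::real)" and U: "U \<noteq> {}"
  shows "coercive_hamiltonian U (\<lambda>x p. norm p - V (x \<bullet> e))"
  unfolding coercive_hamiltonian_def
proof (rule filterlim_at_top_mono)
  show "filterlim (\<lambda>p::'a. norm p - M) at_top at_infinity"
    using filterlim_tendsto_add_at_top[OF tendsto_const[of "- M"] filterlim_norm_at_top]
    by (simp add: add.commute)
  show "\<forall>\<^sub>F p in at_infinity. norm p - M \<le> (INF x\<in>closure U. norm p - V (x \<bullet> e))"
    using V U by (intro always_eventually allI cINF_greatest) (auto simp: diff_left_mono)
qed

lemma eikonal_locally_lipschitz:
  assumes V: "\<And>x y. \<bar>V x - V y\<bar> \<le> L * \<bar>x - y\<bar>" and L: "1 \<le> L" and e: "norm e = 1"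
  shows "locally_lipschitz_hamiltonian U (\<lambda>x p. norm p - V (x \<bullet> e))"
  unfolding locally_lipschitz_hamiltonian_def
proof (intro allI impI exI[of _ L] ballI conjI)
  fix x y p q :: 'a
  have "\<bar>x \<bullet> e - y \<bullet> e\<bar> \<le> norm (x - y)"
    using Cauchy_Schwarz_ineq2[of "x - y" e] e by (simp add: inner_diff_left)
  then have "L * \<bar>x \<bullet> e - y \<bullet> e\<bar> \<le> L * norm (x - y)" using L by simp
  then have "\<bar>V (x \<bullet> e) - V (y \<bullet> e)\<bar> \<le> L * norm (x - y)"
    by (rule order_trans[OF V])
  then show "\<bar>norm p - V (x \<bullet> e) - (norm p - V (y \<bullet> e))\<bar> \<le> L * norm (x - y)" by simp
  show "\<bar>norm p - V (x \<bullet> e) - (norm q - V (x \<bullet> e))\<bar> \<le> L * norm (p - q)"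
    using norm_triangle_ineq3[of p q] mult_right_mono[OF L norm_ge_zero[of "p - q"]] by simp
qed

lemma eikonal_convex: "convex_hamiltonian U (\<lambda>x p. norm p - V (x \<bullet> e))"
  unfolding convex_hamiltonian_def
proof
  fix x
  have "convex_on UNIV (\<lambda>p::'a. norm p)"
    using convex_on_dist[of UNIV "0::'a"] by (simp add: convex_UNIV)
  then show "convex_on UNIV (\<lambda>p::'a. norm p - V (x \<bullet> e))"
    by (auto simp: convex_on_def algebra_simps simp flip: distrib_right)
qed

theorem theorem1p8:
  shows "\<exists>(\<Omega> :: (real ^ 'n) set) U R0 (H :: real ^ 'n \<Rightarrow> real ^ 'n \<Rightarrow> real).
    open \<Omega> \<and> bounded \<Omega> \<and> connected \<Omega> \<and> 0 \<in> \<Omega> \<and>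
    R0 > 0 \<and> U = ball 0 R0 \<and> dilate 2 \<Omega> \<subseteq> U \<and>
    continuous_on (closure U \<times> UNIV) (\<lambda>(x, p). H x p) \<and>
    locally_lipschitz_hamiltonian U H \<and>
    coercive_hamiltonian U H \<and>
    convex_hamiltonian U H \<and>
    strongly_star_shaped \<Omega> \<and>
    (\<forall>r :: real \<Rightarrow> real.
      continuous_on {0<..} r \<longrightarrow> (\<forall>l>0. r l \<le> 0) \<longrightarrow> (r \<longlongrightarrow> 0) (at_right 0) \<longrightarrow>
      (\<forall>\<epsilon>>0. \<exists>l\<in>{0<..<\<epsilon>}. r l \<noteq> 0) \<longrightarrow>
      (\<exists>(\<phi> :: real \<Rightarrow> real) (lam :: nat \<Rightarrow> real).
        continuous_on {0<..} \<phi> \<and> mono_on {0<..} \<phi> \<and> (\<forall>l>0. \<phi> l > 0) \<and>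
        (\<phi> \<longlongrightarrow> 0) (at_right 0) \<and>
        (\<forall>j. lam j > 0 \<and> 1 + r (lam j) > 0) \<and> lam \<longlonglongrightarrow> 0 \<and>
        filterlim (\<lambda>j. r (lam j) / \<phi> (lam j)) at_bot sequentially \<and>
        \<not> converges_locally_uniformly \<Omega>
            (\<lambda>j x. the_state_constraint_solution (\<phi> (lam j)) H (dilate (1 + r (lam j)) \<Omega>) x
                 + additive_eigenvalue H (dilate (1 + r (lam j)) \<Omega>) / \<phi> (lam j))))"
proof -
  obtain e :: "real ^ 'n" where e: "e \<in> Basis" using nonempty_Basis by blast
  let ?H = "\<lambda>(x :: real ^ 'n) p. norm p - potential 1 (x \<bullet> e)"
  have "bounded (dilate 2 (cube 1 :: (real ^ 'n) set))"
    unfolding dilate_def by (rule bounded_scaling[OF bounded_cube])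
  then obtain R0 where R0: "R0 > 0" "dilate 2 (cube 1) \<subseteq> ball (0 :: real ^ 'n) R0"
    using bounded_subset_ballD by blast
  let ?U = "ball (0 :: real ^ 'n) R0"
  have "continuous_on (closure ?U \<times> UNIV) (\<lambda>(x, p). ?H x p)"
    unfolding case_prod_beta
    by (intro continuous_intros continuous_on_compose2[OF continuous_potential[of 1]]) auto
  moreover have "locally_lipschitz_hamiltonian ?U ?H"
    using e by (intro eikonal_locally_lipschitz[where L=3] potential_lipschitz) auto
  moreover have "coercive_hamiltonian ?U ?H"
    using R0 by (intro eikonal_coercive[where M=2] potential_le_2) auto
  moreover have "convex_hamiltonian ?U ?H" by (rule eikonal_convex)
  moreover note strongly_star_shaped_cube
    divergent_discount_exists[OF e, unfolded normalized_solution_def[abs_def]]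
  ultimately show ?thesis
    using R0 open_cube bounded_cube convex_connected[OF convex_cube] zero_in_cube[OF zero_less_one]
    by (intro exI[of _ "cube 1"] exI[of _ ?U] exI[of _ R0] exI[of _ ?H] conjI allI impI)
      (assumption | rule refl | blast)+
qed

end
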